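(* Let $p>0$, let $g:\mathbb{R}^n\to[0,\infty)$ be a continuous function that is $p$-concave and $\frac1p$-homogeneous, and let $\mu$ be the measure on $\mathbb{R}^n$ with density $g$ with respect to Lebesgue measure. Let $(u_i)_{i=1}^n$ be an orthonormal basis of $\mathbb{R}^n$ such that $[-u_i,u_i]\cap \operatorname{supp}(g)\neq\varnothing$ for each $1\le i\le n$. Then for any convex body $K\subset\mathbb{R}^n$, $$\mu(K)^{n+\frac1p-1}\le 2^{n+\frac1p}\left(1+\frac{1}{pn}\right)^n\left(\sum_{k=1}^n\tilde g^p(u_k)\right)^{-\frac1p}\prod_{i=1}^n P_{\mu,K}(u_i)^{1+\frac{\tilde g^p(u_i)}{p\sum_{k=1}^n\tilde g^p(u_k)}}.$$
   Context: A convex body is a compact convex subset of $\mathbb{R}^n$ with nonempty interior. For a function $g$ on $\mathbb{R}^n$ with nonnegative values, $\operatorname{supp}(g)=\{x: g(x)>0\}$ (not its closure). The function $g$ is $p$-concave ($p>0$) if for all $\lambda\in[0,1]$ and all $x,y\in\operatorname{supp}(g)$, $g(\lambda x+(1-\lambda)y)\ge(\lambda g^p(x)+(1-\lambda)g^p(y))^{1/p}$, where $g^p(x)=g(x)^p$. It is $r$-homogeneous if $g(ax)=a^r g(x)$ for all $a>0$, $x\in\mathbb{R}^n$. Write $\tilde g(x)=g(x)+g(-x)$ and $\tilde g^p(x)=(\tilde g(x))^p$. For $\theta\in\mathbb{R}^n$, $[-\theta,\theta]=\{t\theta: t\in[-1,1]\}$. For measurable sets $A,B\subset\mathbb{R}^n$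 the mixed $\mu$-measure is $$\mu_1(A,B)=\liminf_{\varepsilon\to0^+}\frac{\mu(A+\varepsilon B)-\mu(A)}{\varepsilon},$$ where $A+\varepsilon B$ is the Minkowski sum. For a unit vector $\theta\in S^{n-1}$ and a convex body $K$, $$P_{\mu,K}(\theta)=\frac n2\int_0^1\mu_1(tK,[-\theta,\theta])\,dt.$$ *)

theory Defs
  imports "HOL-Analysis.Analysis"
begin

definition convex_body :: "(real^'n) set \<Rightarrow> bool" where
  "convex_body K \<longleftrightarrow> compact K \<and> convex K \<and> interior K \<noteq> {}"

text \<open>The set of positivity itself, not its closure.\<close>
definition pos_supp :: "(real^'n \<Rightarrow> real) \<Rightarrow> (real^'n) set" where
  "pos_supp g = {x. g x > 0}"

definition p_concave :: "real \<Rightarrow> (real^'n \<Rightarrow> real) \<Rightarrow> bool" where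
  "p_concave p g \<longleftrightarrow>
     (\<forall>l\<in>{0..1}. \<forall>x\<in>pos_supp g. \<forall>y\<in>pos_supp g.
        g (l *\<^sub>R x + (1 - l) *\<^sub>R y)
          \<ge> (l * g x powr p + (1 - l) * g y powr p) powr (1 / p))"

definition homogeneous_of_degree :: "real \<Rightarrow> (real^'n \<Rightarrow> real) \<Rightarrow> bool" where
  "homogeneous_of_degree r g \<longleftrightarrow> (\<forall>a>0. \<forall>x. g (a *\<^sub>R x) = a powr r * g x)"

definition g_tilde :: "(real^'n \<Rightarrow> real) \<Rightarrow> real^'n \<Rightarrow> real" where
  "g_tilde g x = g x + g (- x)"

definition sym_segment :: "real^'n \<Rightarrow> (real^'n) set" where
  "sym_segment \<theta> = {t *\<^sub>R \<theta> | t. t \<in> {-1..1}}"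

definition orthonormal_basis :: "('n \<Rightarrow> real^'n) \<Rightarrow> bool" where
  "orthonormal_basis u \<longleftrightarrow>
     (\<forall>i j. u i \<bullet> u j = (if i = j then 1 else 0)) \<and> span (range u) = UNIV"

text \<open>The sum of sets is the Minkowski sum of \<^theory>\<open>HOL-Library.Set_Algebras\<close>. The lower limit is
  taken in the extended reals, where it always exists.\<close>
definition mixed_measure ::
    "(real^'n) measure \<Rightarrow> (real^'n) set \<Rightarrow> (real^'n) set \<Rightarrow> ereal" where
  "mixed_measure \<mu> A B =
     Liminf (at_right (0::real))
       (\<lambda>\<epsilon>. (enn2ereal (emeasure \<mu> (A + (\<lambda>b. \<epsilon> *\<^sub>R b) ` B)) - enn2ereal (emeasure \<mu> A))
              / ereal \<epsilon>)"

text \<open>If \<open>\<mu>\<close> has a continuous density, \<open>K\<close> is a convex body and \<open>t > 0\<close>, then the mixed measure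
  below is finite and nonnegative, since the volume of the \<open>\<epsilon>\<close>-enlargement of \<open>t K\<close> exceeds that of
  \<open>t K\<close> by \<open>O(\<epsilon>)\<close>; the coercion to the reals then loses nothing. If moreover the density is
  homogeneous of degree \<open>1/p\<close>, the integrand is a constant multiple of \<open>t powr (n + 1/p - 1)\<close>, so
  it is integrable.\<close>
definition P_fun :: "(real^'n) measure \<Rightarrow> (real^'n) set \<Rightarrow> real^'n \<Rightarrow> real" where
  "P_fun \<mu> K \<theta> =
     real CARD('n) / 2 *
       (LBINT t:{0..1}. real_of_ereal (mixed_measure \<mu> ((\<lambda>x. t *\<^sub>R x) ` K) (sym_segment \<theta>)))"

end

theory Submission
  imports Defs
begin

text \<open>
  Write \<open>N = n + 1/p\<close> and \<open>I\<^sub>i = [-u\<^sub>i, u\<^sub>i]\<close>. The density is log-concave, so the Prekopa--Leindler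
  inequality together with \<open>\<mu>(t A) = t powr N * \<mu>(A)\<close> gives Minkowski's first inequality
  \<open>\<Sum>i. l\<^sub>i * \<mu>\<^sub>1(K, I\<^sub>i) \<ge> N * \<mu>(K) powr (1 - 1/N) * \<mu>(Z) powr (1/N)\<close> for the box \<open>Z = \<Sum>i. l\<^sub>i I\<^sub>i\<close>.
  Additivity of \<open>\<mu>\<^sub>1(K, \<cdot>)\<close> along the \<open>I\<^sub>i\<close> holds because \<open>\<mu>\<^sub>1(K, I\<^sub>i)\<close> is an honest limit, the
  integral of the density over the two ends of the chords of \<open>K\<close> parallel to \<open>u\<^sub>i\<close>, and these ends
  depend continuously on \<open>K\<close> under approximation from outside.

  Exactly one of \<open>\<plusminus>u\<^sub>i\<close> lies in the support, and \<open>g powr p\<close> is superadditive there; with the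
  weighted AM--GM inequality this bounds \<open>\<mu>(Z)\<close> from below by a product of powers of the \<open>l\<^sub>i\<close>.
  By homogeneity \<open>P(u\<^sub>i) = n / (2 N) * \<mu>\<^sub>1(K, I\<^sub>i)\<close>, and the theorem follows from the choice
  \<open>l\<^sub>i = 1 / P(u\<^sub>i)\<close>.
\<close>

subsection \<open>The Prekopa--Leindler inequality\<close>

text \<open>Prekopa--Leindler bounds the measure of a midpoint from below only by a geometric mean.
  Scaling the box until it has the measure of \<open>K\<close> makes that mean equal to
  \<open>mu(K)\<close>, and homogeneity of degree \<open>N\<close> then restores the power
  \<open>1 / N\<close>. The full strength of p-concavity is spent on the lower bound for the box.
  The lower limit of a sum may exceed the sum of the lower limits, which is the wrong direction for
  adding up the sides of the box; hence the need for honest limits. Constants: let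
  \<open>a i\<close> be the p-th power of \<open>g_tilde g (u i)\<close> and \<open>S\<close> their
  sum. AM--GM with weights \<open>a i / S\<close> bounds the density on part of the box below by a
  product whose factors integrate to \<open>l i powr e i / e i\<close> with
  \<open>e i = 1 + a i / (p * S)\<close>. These exponents sum to \<open>N\<close>, so AM--GM bounds
  their product by \<open>(1 + 1 / (p * n)) ^ n\<close>. With \<open>l i = 1 / P(u i)\<close> every
  term \<open>l i * mu_1(K, I i)\<close> is \<open>2 * N / n\<close>; the sum is
  \<open>2 * N\<close>, the factor \<open>N\<close> cancels, and the remaining \<open>2\<close> is
  raised to the power \<open>N\<close>.\<close>

lemma emeasure_lborel_inner_compact:
  fixes A :: "'a::euclidean_space set"
  assumes A [measurable]: "A \<in> sets borel"
  shows "emeasure lborel A = (SUP C\<in>{C. C \<subseteq> A \<and> compact C}. emeasure lborel C)"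
proof (rule antisym)
  let ?S = "SUP C\<in>{C. C \<subseteq> A \<and> compact C}. emeasure lborel C"
  have le: "emeasure lborel (A \<inter> cball 0 (real k)) \<le> ?S" for k
  proof -
    \<comment> \<open>Inner regularity is applied to a finite measure, hence the restriction to a
      ball; the balls exhaust the space afterwards.\<close>
    let ?M = "density lborel (indicator (cball (0::'a) (real k)))"
    have *: "emeasure ?M B = emeasure lborel (B \<inter> cball 0 (real k))" if "B \<in> sets borel" for B
    proof -
      have "emeasure ?M B = (\<integral>\<^sup>+x. indicator (cball 0 (real k)) x * indicator B x \<partial>lborel)"
        using that by (intro emeasure_density) (auto intro!: borel_measurable_indicator)
      also have "\<dots> = (\<integral>\<^sup>+x. indicator (B \<inter> cball 0 (real k)) x \<partial>lborel)"
        by (intro nn_integral_cong) (auto split: split_indicator)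
      finally show ?thesis
        using that by simp
    qed
    have "emeasure ?M (space ?M) \<noteq> \<infinity>"
      using * [of UNIV] emeasure_lborel_cball_finite[of "0::'a" "real k"] by (simp add: less_top)
    then have "emeasure ?M A = (SUP C\<in>{C. C \<subseteq> A \<and> compact C}. emeasure ?M C)"
      by (intro inner_regular) auto
    also have "\<dots> \<le> ?S"
    proof (intro SUP_mono)
      fix C assume C: "C \<in> {C. C \<subseteq> A \<and> compact C}"
      then have "emeasure ?M C \<le> emeasure lborel C"
        by (subst *) (auto intro!: emeasure_mono simp: borel_compact)
      then show "\<exists>D\<in>{C. C \<subseteq> A \<and> compact C}. emeasure ?M C \<le> emeasure lborel D"
        using C by auto
    qed
    finally show ?thesis
      using * [OF A] by simp
  qed
  have "emeasure lborel A = (SUP k. emeasure lborel (A \<inter> cball 0 (real k)))"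
  proof -
    have "(SUP k. emeasure lborel (A \<inter> cball 0 (real k)))
        = emeasure lborel (\<Union>k. A \<inter> cball 0 (real k))"
      by (intro SUP_emeasure_incseq) (auto simp: incseq_def)
    also have "(\<Union>k. A \<inter> cball 0 (real k)) = A"
      by (auto intro: real_arch_simple)
    finally show ?thesis ..
  qed
  also have "\<dots> \<le> ?S"
    by (intro SUP_least le)
  finally show "emeasure lborel A \<le> ?S" .
  show "?S \<le> emeasure lborel A"
    by (auto intro!: SUP_least emeasure_mono)
qed

section \<open>Brunn--Minkowski on the line, in midpoint form\<close>

lemma emeasure_lborel_real_preimage_affine:
  fixes A :: "real set"
  assumes [measurable]: "A \<in> sets borel" and c: "c \<noteq> 0"
  shows "emeasure lborel A = ennreal \<bar>c\<bar> * emeasure lborel {x. t + c * x \<in> A}"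
proof -
  have "emeasure lborel A = (\<integral>\<^sup>+x. indicator A x \<partial>lborel)"
    by simp
  also have "\<dots> = \<bar>c\<bar> * (\<integral>\<^sup>+x. indicator A (t + c * x) \<partial>lborel)"
    using c by (intro nn_integral_real_affine) auto
  also have "(\<integral>\<^sup>+x. indicator A (t + c * x) \<partial>lborel)
      = (\<integral>\<^sup>+x. indicator {x. t + c * x \<in> A} x \<partial>lborel)"
    by (intro nn_integral_cong) (auto split: split_indicator)
  also have "\<dots> = emeasure lborel {x. t + c * x \<in> A}"
    by simp
  finally show ?thesis .
qed

text \<open>With \<open>a = max A\<close> and \<open>b = min B\<close>, the sets
  \<open>A' = (A + b) / 2\<close> and \<open>B' = (a + B) / 2\<close> lie in \<open>M\<close> on
  different sides of \<open>(a + b) / 2\<close>, so their lengths add. A measurable \<open>M\<close>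
  takes the place of the Minkowski mean, which need not be Borel when \<open>A\<close> and
  \<open>B\<close> are.\<close>

lemma brunn_minkowski_midpoint_compact_real:
  fixes A B M :: "real set"
  assumes A: "compact A" "A \<noteq> {}" and B: "compact B" "B \<noteq> {}"
    and M [measurable]: "M \<in> sets borel"
    and mid: "\<And>a b. a \<in> A \<Longrightarrow> b \<in> B \<Longrightarrow> (a + b) / 2 \<in> M"
  shows "emeasure lborel A + emeasure lborel B \<le> 2 * emeasure lborel M"
proof -
  have [measurable]: "A \<in> sets borel" "B \<in> sets borel"
    using A B by (auto intro: borel_compact)
  obtain a where a: "a \<in> A" "\<And>x. x \<in> A \<Longrightarrow> x \<le> a"
    using compact_attains_sup[of A] A by auto
  obtain b where b: "b \<in> B" "\<And>x. x \<in> B \<Longrightarrow> b \<le> x"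
    using compact_attains_inf[of B] B by auto
  define A' where "A' = {x. (- b) + 2 * x \<in> A}"
  define B' where "B' = {x. (- a) + 2 * x \<in> B}"
  have [measurable]: "A' \<in> sets borel" "B' \<in> sets borel"
    unfolding A'_def B'_def by measurable
  have A': "x \<in> M" "x \<le> (a + b) / 2" if "x \<in> A'" for x
    using mid[of "-b + 2 * x" b] a(2)[of "-b + 2 * x"] that b by (auto simp: A'_def)
  have B': "x \<in> M" "x \<ge> (a + b) / 2" if "x \<in> B'" for x
    using mid[of a "-a + 2 * x"] b(2)[of "-a + 2 * x"] that a by (auto simp: B'_def)
  have "emeasure lborel A + emeasure lborel B = 2 * (emeasure lborel A' + emeasure lborel B')"
    using emeasure_lborel_real_preimage_affine[of A 2 "-b"]
      emeasure_lborel_real_preimage_affine[of B 2 "-a"]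
    by (simp add: A'_def B'_def distrib_left)
  also have "emeasure lborel A' + emeasure lborel B' = emeasure lborel (A' \<union> B')"
  proof (rule emeasure_Un'[symmetric])
    have "A' \<inter> B' \<subseteq> {(a + b) / 2}"
      using A' B' by force
    then show "A' \<inter> B' \<in> null_sets lborel"
      by (meson countable_finite countable_imp_null_set_lborel countable_subset finite.emptyI
          finite.insertI)
  qed auto
  also have "2 * emeasure lborel (A' \<union> B') \<le> 2 * emeasure lborel M"
    using A' B' by (intro mult_left_mono emeasure_mono) auto
  finally show ?thesis .
qed

lemma brunn_minkowski_midpoint_real:
  fixes A B M :: "real set"
  assumes A: "A \<in> sets borel" "A \<noteq> {}" and B: "B \<in> sets borel" "B \<noteq> {}"
    and M [measurable]: "M \<in> sets borel"
    and mid: "\<And>a b. a \<in> A \<Longrightarrow> b \<in> B \<Longrightarrow> (a + b) / 2 \<in> M"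
  shows "emeasure lborel A + emeasure lborel B \<le> 2 * emeasure lborel M"
proof -
  have *: "emeasure lborel C + emeasure lborel D \<le> 2 * emeasure lborel M"
    if C: "C \<subseteq> A" "compact C" and D: "D \<subseteq> B" "compact D" for C D
  proof -
    \<comment> \<open>The compact sets may be empty; inserting a point of \<open>A\<close> and of
      \<open>B\<close> makes the compact case applicable.\<close>
    obtain a b where ab: "a \<in> A" "b \<in> B"
      using A B by auto
    have "emeasure lborel C + emeasure lborel D
        \<le> emeasure lborel (insert a C) + emeasure lborel (insert b D)"
      using C D by (intro add_mono emeasure_mono) (auto intro: borel_compact)
    also have "\<dots> \<le> 2 * emeasure lborel M"
      using C D ab by (intro brunn_minkowski_midpoint_compact_real mid) auto
    finally show ?thesis .
  qed
  have "emeasure lborel C + emeasure lborel B \<le> 2 * emeasure lborel M"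
    if C: "C \<subseteq> A" "compact C" for C
    unfolding emeasure_lborel_inner_compact[OF B(1)]
    by (subst ennreal_SUP_add_right) (auto intro!: SUP_least * C)
  then show ?thesis
    unfolding emeasure_lborel_inner_compact[OF A(1)]
    by (subst ennreal_SUP_add_left[symmetric]) (auto intro!: SUP_least)
qed

section \<open>From superlevel sets to Prekopa--Leindler on the line\<close>

lemma nn_integral_indicator_less_ennreal:
  "(\<integral>\<^sup>+r. indicator {r. 0 < r \<and> ennreal r < c} r \<partial>lborel) = c"
proof (cases c)
  case (real t)
  have "{r. 0 < r \<and> ennreal r < c} = {0<..<t}"
    using real by (auto simp: ennreal_less_iff)
  then show ?thesis
    using real by simp
next
  case top
  have "of_nat k \<le> emeasure lborel {0::real<..}" for k
  proof -
    have "emeasure lborel {0<..real k} \<le> emeasure lborel {0::real<..}"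
      by (intro emeasure_mono) auto
    then show ?thesis
      by (simp add: ennreal_of_nat_eq_real_of_nat)
  qed
  then have "emeasure lborel {0::real<..} = top"
    by (metis ennreal_Ex_less_of_nat leD top.not_eq_extremum)
  moreover have "{r. 0 < r \<and> ennreal r < c} = {0<..}"
    using top by auto
  ultimately show ?thesis
    using top by simp
qed

lemma nn_integral_layer_cake:
  fixes f :: "'a::euclidean_space \<Rightarrow> ennreal"
  assumes [measurable]: "f \<in> borel_measurable borel"
  shows "(\<integral>\<^sup>+x. f x \<partial>lborel)
    = (\<integral>\<^sup>+r. indicator {0<..} r * emeasure lborel {x. ennreal r < f x} \<partial>lborel)"
proof -
  have "(\<integral>\<^sup>+x. f x \<partial>lborel)
      = (\<integral>\<^sup>+x. \<integral>\<^sup>+r. indicator {r. 0 < r \<and> ennreal r < f x} r \<partial>lborel \<partial>lborel)"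
    by (simp only: nn_integral_indicator_less_ennreal)
  also have "\<dots> = (\<integral>\<^sup>+x. \<integral>\<^sup>+r. indicator {z. 0 < snd z \<and> ennreal (snd z) < f (fst z)} (x, r)
      \<partial>lborel \<partial>lborel)"
    by (intro nn_integral_cong) (auto split: split_indicator)
  also have "\<dots> = (\<integral>\<^sup>+r. \<integral>\<^sup>+x. indicator {z. 0 < snd z \<and> ennreal (snd z) < f (fst z)} (x, r)
      \<partial>lborel \<partial>lborel)"
    by (intro lborel_pair.Fubini'[symmetric]) measurable
  also have "\<dots> = (\<integral>\<^sup>+r. \<integral>\<^sup>+x. indicator {0<..} r * indicator {x. ennreal r < f x} x
      \<partial>lborel \<partial>lborel)"
    by (intro nn_integral_cong) (auto split: split_indicator)
  finally show ?thesis
    by (simp add: nn_integral_cmult)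
qed

lemma ennreal_power2_less_mult:
  fixes x y :: ennreal
  assumes "0 < r" "ennreal r < x" "ennreal r < y"
  shows "ennreal r * ennreal r < x * y"
proof (cases "x = top \<or> y = top")
  case True
  then have "x * y = top"
    using assms by (auto simp: ennreal_mult_eq_top_iff)
  moreover have "ennreal r * ennreal r < top"
    by (simp add: ennreal_mult_less_top)
  ultimately show ?thesis
    by simp
next
  case False
  then obtain s t where "0 \<le> s" "x = ennreal s" "0 \<le> t" "y = ennreal t"
    by (metis ennreal_cases)
  then show ?thesis
    using assms by (simp add: ennreal_mult[symmetric] ennreal_less_iff mult_strict_mono)
qed

text \<open>Equal suprema make the superlevel sets of \<open>f\<close> and \<open>h\<close> nonempty
  for exactly the same levels below \<open>1\<close>, so Brunn--Minkowski applies level by level and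
  the layer-cake formula integrates it. The result bounds the arithmetic mean of the integrals,
  which is more than the geometric mean.\<close>

lemma prekopa_leindler_midpoint_normalized:
  fixes f h m :: "real \<Rightarrow> ennreal"
  assumes [measurable]: "f \<in> borel_measurable borel" "h \<in> borel_measurable borel"
      "m \<in> borel_measurable borel"
    and f1: "(SUP x. f x) = 1" and h1: "(SUP x. h x) = 1"
    and mid: "\<And>x y. f x * h y \<le> (m ((x + y) / 2))\<^sup>2"
  shows "(\<integral>\<^sup>+x. f x \<partial>lborel) + (\<integral>\<^sup>+x. h x \<partial>lborel) \<le> 2 * (\<integral>\<^sup>+x. m x \<partial>lborel)"
proof -
  have *: "emeasure lborel {x. ennreal r < f x} + emeasure lborel {x. ennreal r < h x}
      \<le> 2 * emeasure lborel {x. ennreal r < m x}" if "r > 0" for r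
  proof (cases "r < 1")
    case True
    have ne: "{x. ennreal r < f x} \<noteq> {}" "{x. ennreal r < h x} \<noteq> {}"
      using True less_SUP_iff[of "ennreal r" f UNIV] less_SUP_iff[of "ennreal r" h UNIV] f1 h1 that
      by (auto simp: ennreal_less_one_iff)
    show ?thesis
    proof (rule brunn_minkowski_midpoint_real[OF _ ne(1) _ ne(2)])
      fix a b assume ab: "a \<in> {x. ennreal r < f x}" "b \<in> {x. ennreal r < h x}"
      then have "ennreal r * ennreal r < f a * h b"
        using that by (intro ennreal_power2_less_mult) auto
      also have "\<dots> \<le> (m ((a + b) / 2))\<^sup>2"
        by (rule mid)
      finally show "(a + b) / 2 \<in> {x. ennreal r < m x}"
        by (metis leD leI mem_Collect_eq mult_mono power2_eq_square zero_le)
    qed measurable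
  next
    case False
    then have "1 \<le> ennreal r"
      by simp
    moreover have "f x \<le> 1" "h x \<le> 1" for x
      using f1 h1 by (metis UNIV_I SUP_upper)+
    ultimately have "f x \<le> ennreal r" "h x \<le> ennreal r" for x
      by (metis order_trans)+
    then have "{x. ennreal r < f x} = {}" "{x. ennreal r < h x} = {}"
      by (metis (no_types, lifting) Collect_empty_eq not_less)+
    then show ?thesis
      by simp
  qed
  have "(\<integral>\<^sup>+x. f x \<partial>lborel) + (\<integral>\<^sup>+x. h x \<partial>lborel)
      = (\<integral>\<^sup>+r. indicator {0<..} r * emeasure lborel {x. ennreal r < f x}
              + indicator {0<..} r * emeasure lborel {x. ennreal r < h x} \<partial>lborel)"
    by (simp add: nn_integral_layer_cake[of f] nn_integral_layer_cake[of h] nn_integral_add)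
  also have "\<dots> \<le> (\<integral>\<^sup>+r. 2 * (indicator {0<..} r * emeasure lborel {x. ennreal r < m x}) \<partial>lborel)"
    by (intro nn_integral_mono) (auto simp: * split: split_indicator)
  also have "\<dots> = 2 * (\<integral>\<^sup>+x. m x \<partial>lborel)"
    by (simp add: nn_integral_layer_cake[of m] nn_integral_cmult)
  finally show ?thesis .
qed

lemma ennreal_four_mult_le_square_add:
  fixes x y :: ennreal
  shows "4 * (x * y) \<le> (x + y)\<^sup>2"
proof (cases "x = top \<or> y = top")
  case True
  then have "(x + y)\<^sup>2 = top"
    by (auto simp: power2_eq_square)
  then show ?thesis
    by (metis top_greatest)
next
  case False
  then obtain r s where rs: "0 \<le> r" "x = ennreal r" "0 \<le> s" "y = ennreal s"
    by (metis ennreal_cases)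
  have "4 * (x * y) = ennreal (4 * (r * s))"
    using rs by (simp add: ennreal_mult)
  also have "\<dots> \<le> ennreal ((r + s)\<^sup>2)"
    using zero_le_power2[of "r - s"]
    by (intro ennreal_leI) (simp add: power2_eq_square algebra_simps)
  also have "\<dots> = (x + y)\<^sup>2"
    using rs by (simp add: ennreal_power[symmetric])
  finally show ?thesis .
qed

text \<open>Dividing \<open>f\<close> and \<open>h\<close> by their suprema reduces to the
  normalized case; \<open>m\<close> is multiplied by the \<open>c\<close> with
  \<open>c\<^sup>2 = a * b\<close>, which preserves \<open>mid\<close>. AM--GM turns the resulting
  sum into a product, and the scaling factors cancel.\<close>

lemma prekopa_leindler_midpoint_bounded:
  fixes f h m :: "real \<Rightarrow> ennreal"
  assumes [measurable]: "f \<in> borel_measurable borel" "h \<in> borel_measurable borel"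
      "m \<in> borel_measurable borel"
    and f1: "(SUP x. f x) < top" and h1: "(SUP x. h x) < top"
    and mid: "\<And>x y. f x * h y \<le> (m ((x + y) / 2))\<^sup>2"
  shows "(\<integral>\<^sup>+x. f x \<partial>lborel) * (\<integral>\<^sup>+x. h x \<partial>lborel) \<le> (\<integral>\<^sup>+x. m x \<partial>lborel)\<^sup>2"
proof (cases "(SUP x. f x) = 0 \<or> (SUP x. h x) = 0")
  case True
  then have "(\<forall>x. f x = 0) \<or> (\<forall>x. h x = 0)"
    by (metis SUP_upper UNIV_I le_zero_eq)
  then show ?thesis
    by auto
next
  case False
  obtain F where F: "(SUP x. f x) = ennreal F" "F > 0"
    using f1 False by (cases "SUP x. f x") (auto simp: less_le)
  obtain H where H: "(SUP x. h x) = ennreal H" "H > 0"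
    using h1 False by (cases "SUP x. h x") (auto simp: less_le)
  define a b c where "a = ennreal (1 / F)" and "b = ennreal (1 / H)"
    and "c = ennreal (sqrt (1 / F * (1 / H)))"
  have c2: "c\<^sup>2 = a * b"
    using F(2) H(2) unfolding a_def b_def c_def
    by (simp add: ennreal_power ennreal_mult[symmetric])
  have "(\<integral>\<^sup>+x. a * f x \<partial>lborel) + (\<integral>\<^sup>+x. b * h x \<partial>lborel) \<le> 2 * (\<integral>\<^sup>+x. c * m x \<partial>lborel)"
  proof (rule prekopa_leindler_midpoint_normalized)
    show "(SUP x. a * f x) = 1" "(SUP x. b * h x) = 1"
      using F H by (simp_all add: SUP_mult_left_ennreal[symmetric] a_def b_def
          ennreal_mult[symmetric])
    show "a * f x * (b * h y) \<le> (c * m ((x + y) / 2))\<^sup>2" for x y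
      using mult_left_mono[OF mid[of x y], of "c\<^sup>2"]
      by (simp add: power_mult_distrib c2 mult_ac)
  qed auto
  then have *: "a * (\<integral>\<^sup>+x. f x \<partial>lborel) + b * (\<integral>\<^sup>+x. h x \<partial>lborel) \<le> 2 * (c * (\<integral>\<^sup>+x. m x \<partial>lborel))"
    by (simp add: nn_integral_cmult)
  have "4 * (a * b * ((\<integral>\<^sup>+x. f x \<partial>lborel) * (\<integral>\<^sup>+x. h x \<partial>lborel)))
      \<le> (a * (\<integral>\<^sup>+x. f x \<partial>lborel) + b * (\<integral>\<^sup>+x. h x \<partial>lborel))\<^sup>2"
    using ennreal_four_mult_le_square_add[of "a * (\<integral>\<^sup>+x. f x \<partial>lborel)" "b * (\<integral>\<^sup>+x. h x \<partial>lborel)"]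
    by (simp add: mult_ac)
  also have "\<dots> \<le> (2 * (c * (\<integral>\<^sup>+x. m x \<partial>lborel)))\<^sup>2"
    using * by (intro power_mono) auto
  also have "\<dots> = 4 * (a * b * (\<integral>\<^sup>+x. m x \<partial>lborel)\<^sup>2)"
    by (simp add: power_mult_distrib c2)
  finally have "4 * a * b * ((\<integral>\<^sup>+x. f x \<partial>lborel) * (\<integral>\<^sup>+x. h x \<partial>lborel))
      \<le> 4 * a * b * (\<integral>\<^sup>+x. m x \<partial>lborel)\<^sup>2"
    by (simp add: mult_ac)
  moreover have "4 * a * b \<noteq> 0" "4 * a * b \<noteq> top"
    using F(2) H(2) by (auto simp: a_def b_def ennreal_mult_eq_top_iff)
  ultimately show ?thesis
    by (simp add: ennreal_mult_le_mult_iff)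
qed

lemma nn_integral_SUP_min_of_nat:
  assumes [measurable]: "f \<in> borel_measurable M"
  shows "(\<integral>\<^sup>+x. f x \<partial>M) = (SUP k. \<integral>\<^sup>+x. min (f x) (of_nat k) \<partial>M)"
proof -
  have "(SUP k. min (f x) (of_nat k)) = f x" for x
  proof (cases "f x = top")
    case True
    then show ?thesis
      by (simp add: ennreal_SUP_of_nat_eq_top)
  next
    case False
    then obtain k :: nat where "f x \<le> of_nat k"
      using ennreal_Ex_less_of_nat by (metis less_imp_le top.not_eq_extremum)
    then show ?thesis
      by (intro antisym SUP_least) (auto intro!: SUP_upper2[of k])
  qed
  then have "(\<integral>\<^sup>+x. f x \<partial>M) = (\<integral>\<^sup>+x. (SUP k. min (f x) (of_nat k)) \<partial>M)"
    by simp
  also have "\<dots> = (SUP k. \<integral>\<^sup>+x. min (f x) (of_nat k) \<partial>M)"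
    by (intro nn_integral_monotone_convergence_SUP)
      (auto simp: incseq_def le_fun_def intro: min.coboundedI2)
  finally show ?thesis .
qed

text \<open>Truncating \<open>f\<close> and \<open>h\<close>, but not \<open>m\<close>, only lowers
  the left side of \<open>mid\<close>. The two truncation levels are independent, so each supremum
  can be taken on its own.\<close>

lemma prekopa_leindler_midpoint_real:
  fixes f h m :: "real \<Rightarrow> ennreal"
  assumes [measurable]: "f \<in> borel_measurable borel" "h \<in> borel_measurable borel"
      "m \<in> borel_measurable borel"
    and mid: "\<And>x y. f x * h y \<le> (m ((x + y) / 2))\<^sup>2"
  shows "(\<integral>\<^sup>+x. f x \<partial>lborel) * (\<integral>\<^sup>+x. h x \<partial>lborel) \<le> (\<integral>\<^sup>+x. m x \<partial>lborel)\<^sup>2"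
proof -
  have "(\<integral>\<^sup>+x. min (f x) (of_nat k) \<partial>lborel) * (\<integral>\<^sup>+x. min (h x) (of_nat l) \<partial>lborel)
      \<le> (\<integral>\<^sup>+x. m x \<partial>lborel)\<^sup>2" for k l
  proof (rule prekopa_leindler_midpoint_bounded)
    have "(SUP x. min (f x) (of_nat k)) \<le> of_nat k" "(SUP x. min (h x) (of_nat l)) \<le> of_nat l"
      by (auto intro!: SUP_least)
    then show "(SUP x. min (f x) (of_nat k)) < top" "(SUP x. min (h x) (of_nat l)) < top"
      using of_nat_less_top order.strict_trans1 by blast+
    show "min (f x) (of_nat k) * min (h y) (of_nat l) \<le> (m ((x + y) / 2))\<^sup>2" for x y
      by (rule order_trans[OF mult_mono mid]) auto
  qed auto
  then show ?thesis
    unfolding nn_integral_SUP_min_of_nat[of f lborel, simplified]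
      nn_integral_SUP_min_of_nat[of h lborel, simplified]
    by (subst SUP_mult_right_ennreal, subst SUP_mult_left_ennreal) (auto intro!: SUP_least)
qed

text \<open>Tensorization: by induction, the integrals over the coordinates in \<open>I\<close>, as
  functions of the new coordinate, satisfy the hypothesis of the one-dimensional inequality. Points
  of the product space are undefined outside \<open>I\<close>, so \<open>mid\<close> is required for
  extensional functions only and the midpoint is restricted likewise.\<close>

lemma prekopa_leindler_midpoint_PiM:
  fixes f h m :: "('i \<Rightarrow> real) \<Rightarrow> ennreal"
  assumes "finite I"
    and "f \<in> borel_measurable (\<Pi>\<^sub>M i\<in>I. lborel)" "h \<in> borel_measurable (\<Pi>\<^sub>M i\<in>I. lborel)"
      "m \<in> borel_measurable (\<Pi>\<^sub>M i\<in>I. lborel)"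
    and "\<And>x y. x \<in> extensional I \<Longrightarrow> y \<in> extensional I \<Longrightarrow>
      f x * h y \<le> (m (\<lambda>i\<in>I. (x i + y i) / 2))\<^sup>2"
  shows "(\<integral>\<^sup>+x. f x \<partial>(\<Pi>\<^sub>M i\<in>I. lborel)) * (\<integral>\<^sup>+x. h x \<partial>(\<Pi>\<^sub>M i\<in>I. lborel))
    \<le> (\<integral>\<^sup>+x. m x \<partial>(\<Pi>\<^sub>M i\<in>I. lborel))\<^sup>2"
  using assms
proof (induction I arbitrary: f h m rule: finite_induct)
  interpret product_sigma_finite "\<lambda>_::'i. lborel :: real measure" ..
  case empty
  have "f (\<lambda>_. undefined) * h (\<lambda>_. undefined) \<le> (m (\<lambda>_. undefined))\<^sup>2"
    using empty(4)[of "\<lambda>_. undefined" "\<lambda>_. undefined"] by (simp add: restrict_def)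
  then show ?case
    by (simp add: PiM_empty nn_integral_count_space_finite)
next
  interpret product_sigma_finite "\<lambda>_::'i. lborel :: real measure" ..
  case (insert i I)
  let ?P = "\<lambda>J::'i set. \<Pi>\<^sub>M i\<in>J. (lborel :: real measure)"
  interpret P: sigma_finite_measure "?P I"
    by (rule sigma_finite) fact
  note [measurable] = insert.prems(1-3)
  have upd [measurable]: "(\<lambda>(x, y). x(i := y)) \<in> ?P I \<Otimes>\<^sub>M lborel \<rightarrow>\<^sub>M ?P (insert i I)"
    by (rule measurable_add_dim)
  have sec: "(\<lambda>x. f' (x(i := y))) \<in> borel_measurable (?P I)"
    if "f' \<in> borel_measurable (?P (insert i I))" for f' :: "('i \<Rightarrow> real) \<Rightarrow> ennreal" and y
    using measurable_compose[OF measurable_compose[OF measurable_Pair2' upd] that, of y]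
    by simp
  have int: "(\<lambda>y. \<integral>\<^sup>+x. f' (x(i := y)) \<partial>?P I) \<in> borel_measurable borel"
    if [measurable]: "f' \<in> borel_measurable (?P (insert i I))" for f' :: "('i \<Rightarrow> real) \<Rightarrow> ennreal"
  proof -
    have "(\<lambda>z. f' ((snd z)(i := fst z))) \<in> borel_measurable (lborel \<Otimes>\<^sub>M ?P I)"
      using measurable_compose[OF measurable_compose[OF measurable_pair_swap' upd] that]
      by (simp add: case_prod_beta)
    then show ?thesis
      using P.borel_measurable_nn_integral[of "\<lambda>y x. f' (x(i := y))" lborel]
      by (simp add: case_prod_beta)
  qed
  have "(\<integral>\<^sup>+y. \<integral>\<^sup>+x. f (x(i := y)) \<partial>?P I \<partial>lborel) * (\<integral>\<^sup>+y. \<integral>\<^sup>+x. h (x(i := y)) \<partial>?P I \<partial>lborel)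
      \<le> (\<integral>\<^sup>+y. \<integral>\<^sup>+x. m (x(i := y)) \<partial>?P I \<partial>lborel)\<^sup>2"
  proof (rule prekopa_leindler_midpoint_real)
    fix s t :: real
    show "(\<integral>\<^sup>+x. f (x(i := s)) \<partial>?P I) * (\<integral>\<^sup>+x. h (x(i := t)) \<partial>?P I)
        \<le> (\<integral>\<^sup>+x. m (x(i := (s + t) / 2)) \<partial>?P I)\<^sup>2"
    proof (rule insert.IH)
      fix x y :: "'i \<Rightarrow> real" assume xy: "x \<in> extensional I" "y \<in> extensional I"
      have "(\<lambda>j\<in>I. (x j + y j) / 2)(i := (s + t) / 2)
          = (\<lambda>j\<in>insert i I. ((x(i := s)) j + (y(i := t)) j) / 2)"
        using insert.hyps(2) by (auto simp: fun_eq_iff)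
      moreover have "x(i := s) \<in> extensional (insert i I)" "y(i := t) \<in> extensional (insert i I)"
        using xy by (auto simp: extensional_def)
      ultimately show "f (x(i := s)) * h (y(i := t))
          \<le> (m ((\<lambda>j\<in>I. (x j + y j) / 2)(i := (s + t) / 2)))\<^sup>2"
        using insert.prems(4) by metis
    qed (intro sec insert.prems)+
  qed (intro int insert.prems)+
  then show ?case
    unfolding product_nn_integral_insert_rev[OF insert.hyps insert.prems(1)]
      product_nn_integral_insert_rev[OF insert.hyps insert.prems(2)]
      product_nn_integral_insert_rev[OF insert.hyps insert.prems(3)] .
qed

text \<open>Lebesgue measure is the image of the product measure under the linear map
  \<open>?T\<close>, which preserves midpoints. Squaring the right side avoids roots of extended
  reals.\<close>

theorem prekopa_leindler_midpoint:
  fixes f h m :: "'a::euclidean_space \<Rightarrow> ennreal"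
  assumes [measurable]: "f \<in> borel_measurable borel" "h \<in> borel_measurable borel"
      "m \<in> borel_measurable borel"
    and mid: "\<And>x y. f x * h y \<le> (m ((1/2) *\<^sub>R (x + y)))\<^sup>2"
  shows "(\<integral>\<^sup>+x. f x \<partial>lborel) * (\<integral>\<^sup>+x. h x \<partial>lborel) \<le> (\<integral>\<^sup>+x. m x \<partial>lborel)\<^sup>2"
proof -
  let ?P = "\<Pi>\<^sub>M b\<in>Basis. (lborel :: real measure)"
  let ?T = "\<lambda>x. \<Sum>b\<in>Basis. x b *\<^sub>R b :: 'a"
  have T [measurable]: "?T \<in> ?P \<rightarrow>\<^sub>M borel"
    by measurable
  have T_int: "(\<integral>\<^sup>+x. k x \<partial>lborel) = (\<integral>\<^sup>+x. k (?T x) \<partial>?P)"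
    if [measurable]: "k \<in> borel_measurable borel" for k :: "'a \<Rightarrow> ennreal"
    by (subst lborel_eq) (simp add: nn_integral_distr)
  show ?thesis
    unfolding T_int[OF assms(1)] T_int[OF assms(2)] T_int[OF assms(3)]
  proof (rule prekopa_leindler_midpoint_PiM)
    fix x y :: "'a \<Rightarrow> real"
    have "?T (\<lambda>i\<in>Basis. (x i + y i) / 2) = (1/2) *\<^sub>R (?T x + ?T y)"
      by (simp add: scaleR_right_distrib sum.distrib scaleR_sum_right add_divide_distrib
          scaleR_left_distrib)
    then show "f (?T x) * h (?T y) \<le> (m (?T (\<lambda>i\<in>Basis. (x i + y i) / 2)))\<^sup>2"
      using mid[of "?T x" "?T y"] by simp
  qed auto
qed

subsection \<open>Changes of variables\<close>

lemma nn_integral_lborel_affine: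
  fixes f :: "'a::euclidean_space \<Rightarrow> ennreal"
  assumes [measurable]: "f \<in> borel_measurable borel" and c: "c \<noteq> 0"
  shows "(\<integral>\<^sup>+x. f x \<partial>lborel) = ennreal (\<bar>c\<bar> ^ DIM('a)) * (\<integral>\<^sup>+x. f (a + c *\<^sub>R x) \<partial>lborel)"
  using c by (subst lborel_affine[of c a])
    (simp_all add: nn_integral_density nn_integral_distr nn_integral_cmult)

lemma nn_integral_lborel_translate:
  fixes f :: "'a::euclidean_space \<Rightarrow> ennreal"
  assumes "f \<in> borel_measurable borel"
  shows "(\<integral>\<^sup>+x. f (x + a) \<partial>lborel) = (\<integral>\<^sup>+x. f x \<partial>lborel)"
  using nn_integral_lborel_affine[OF assms, of 1 a] by (simp add: add.commute)

lemma nn_integral_lborel_reflect: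
  fixes f :: "'a::euclidean_space \<Rightarrow> ennreal"
  assumes "f \<in> borel_measurable borel"
  shows "(\<integral>\<^sup>+x. f (a - x) \<partial>lborel) = (\<integral>\<^sup>+x. f x \<partial>lborel)"
  using nn_integral_lborel_affine[OF assms, of "-1" a] by simp

text \<open>The two integrals are proportional by the uniqueness argument for Haar measure, here carried
  out with the indicator of the unit ball, which has the same integral with and without \<open>T\<close>.\<close>
lemma nn_integral_lborel_isometry:
  fixes T :: "'a::euclidean_space \<Rightarrow> 'a"
  assumes T: "linear T" "\<And>x. norm (T x) = norm x" and T': "\<And>x. T (T' x) = x"
    and [measurable]: "f \<in> borel_measurable borel"
  shows "(\<integral>\<^sup>+x. f (T x) \<partial>lborel) = (\<integral>\<^sup>+x. f x \<partial>lborel)"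
proof -
  have [measurable]: "T \<in> borel_measurable borel"
    using T by (intro borel_measurable_continuous_onI linear_continuous_on linear_conv_bounded_linear[THEN iffD1])
  define h :: "'a \<Rightarrow> ennreal" where "h = indicator (cball 0 1)"
  have [measurable]: "h \<in> borel_measurable borel"
    unfolding h_def by (intro borel_measurable_indicator) auto
  have hT: "h (T x) = h x" for x
    by (auto simp: h_def T split: split_indicator)
  define C where "C = (\<integral>\<^sup>+x. h x \<partial>lborel)"
  have C: "C = emeasure lborel (cball (0::'a) 1)"
    by (simp add: C_def h_def)
  have "C \<noteq> top" unfolding C using emeasure_lborel_cball_finite[of "0::'a" 1] by simp
  have "Gamma (real DIM('a) / 2 + 1) \<noteq> 0"
    by (rule less_imp_neq[OF Gamma_real_pos, symmetric]) simp
  then have "C \<noteq> 0"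
    unfolding C by (simp add: emeasure_cball unit_ball_vol_def)
  have "C * (\<integral>\<^sup>+x. f (T x) \<partial>lborel) = (\<integral>\<^sup>+x. f (T x) * (\<integral>\<^sup>+y. h y \<partial>lborel) \<partial>lborel)"
    by (simp add: C_def[symmetric] nn_integral_multc mult.commute[of C])
  also have "\<dots> = (\<integral>\<^sup>+x. f (T x) * (\<integral>\<^sup>+y. h (y + T x) \<partial>lborel) \<partial>lborel)"
    by (simp add: nn_integral_lborel_translate)
  also have "\<dots> = (\<integral>\<^sup>+x. \<integral>\<^sup>+y. f (T x) * h (y + T x) \<partial>lborel \<partial>lborel)"
    by (simp add: nn_integral_cmult)
  also have "\<dots> = (\<integral>\<^sup>+y. \<integral>\<^sup>+x. f (T x) * h (y + T x) \<partial>lborel \<partial>lborel)"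
    by (intro lborel_pair.Fubini'[symmetric]) measurable
  \<comment> \<open>Replacing \<open>x\<close> by \<open>x - T' y\<close> moves the shift by
    \<open>y\<close> from \<open>h\<close> to \<open>f\<close>. Integrating over \<open>y\<close>
    first then frees \<open>f\<close> of \<open>T\<close> by a reflection, and \<open>hT\<close>
    frees \<open>h\<close> of it.\<close>
  also have "\<dots> = (\<integral>\<^sup>+y. \<integral>\<^sup>+x. f (T x - y) * h (T x) \<partial>lborel \<partial>lborel)"
  proof (rule nn_integral_cong)
    fix y
    have T_shift: "T (x + - T' y) = T x - y" for x
      using T(1) T' by (simp add: linear_diff)
    have "(\<integral>\<^sup>+x. f (T x) * h (y + T x) \<partial>lborel)
        = (\<integral>\<^sup>+x. f (T (x + - T' y)) * h (y + T (x + - T' y)) \<partial>lborel)"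
      by (intro nn_integral_lborel_translate[symmetric]) measurable
    then show "(\<integral>\<^sup>+x. f (T x) * h (y + T x) \<partial>lborel) = (\<integral>\<^sup>+x. f (T x - y) * h (T x) \<partial>lborel)"
      by (simp only: T_shift) simp
  qed
  also have "\<dots> = (\<integral>\<^sup>+x. \<integral>\<^sup>+y. f (T x - y) * h (T x) \<partial>lborel \<partial>lborel)"
    by (intro lborel_pair.Fubini') measurable
  also have "\<dots> = (\<integral>\<^sup>+x. (\<integral>\<^sup>+y. f (T x - y) \<partial>lborel) * h x \<partial>lborel)"
    by (simp add: nn_integral_multc hT)
  also have "\<dots> = C * (\<integral>\<^sup>+x. f x \<partial>lborel)"
    by (simp add: C_def nn_integral_lborel_reflect nn_integral_cmult nn_integral_multc mult.commute)
  finally show ?thesis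
    using \<open>C \<noteq> 0\<close> \<open>C \<noteq> top\<close> by (simp add: ennreal_mult_cancel_left)
qed

text \<open>The slab \<open>0 \<le> x \<bullet> \<theta> < 1\<close> meets every line parallel to \<open>\<theta>\<close> in a set of length \<open>1\<close>, so integrating
  over it replaces the integration over the orthogonal complement of \<open>\<theta>\<close> in Fubini's theorem.\<close>
lemma nn_integral_lborel_slab:
  fixes f :: "'a::euclidean_space \<Rightarrow> ennreal"
  assumes [measurable]: "f \<in> borel_measurable borel" and \<theta>: "\<theta> \<bullet> \<theta> = 1"
  shows "(\<integral>\<^sup>+x. f x \<partial>lborel)
    = (\<integral>\<^sup>+x. indicator {x. 0 \<le> x \<bullet> \<theta> \<and> x \<bullet> \<theta> < 1} x * (\<integral>\<^sup>+s. f (x + s *\<^sub>R \<theta>) \<partial>lborel) \<partial>lborel)"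
proof -
  define h :: "'a \<Rightarrow> ennreal" where "h = indicator {x. 0 \<le> x \<bullet> \<theta> \<and> x \<bullet> \<theta> < 1}"
  have [measurable]: "h \<in> borel_measurable borel"
    unfolding h_def by measurable
  have h1: "(\<integral>\<^sup>+s. h (x - s *\<^sub>R \<theta>) \<partial>lborel) = 1" for x
  proof -
    have "(\<integral>\<^sup>+s. h (x - s *\<^sub>R \<theta>) \<partial>lborel) = (\<integral>\<^sup>+s. indicator {x \<bullet> \<theta> - 1<..x \<bullet> \<theta>} s \<partial>lborel)"
      by (intro nn_integral_cong) (auto simp: h_def inner_diff_left \<theta> split: split_indicator)
    then show ?thesis
      by simp
  qed
  have "(\<integral>\<^sup>+x. h x * (\<integral>\<^sup>+s. f (x + s *\<^sub>R \<theta>) \<partial>lborel) \<partial>lborel)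
      = (\<integral>\<^sup>+x. \<integral>\<^sup>+s. h x * f (x + s *\<^sub>R \<theta>) \<partial>lborel \<partial>lborel)"
    by (simp add: nn_integral_cmult)
  also have "\<dots> = (\<integral>\<^sup>+s. \<integral>\<^sup>+x. h x * f (x + s *\<^sub>R \<theta>) \<partial>lborel \<partial>lborel)"
    by (intro lborel_pair.Fubini'[symmetric]) measurable
  also have "\<dots> = (\<integral>\<^sup>+s. \<integral>\<^sup>+x. h (x - s *\<^sub>R \<theta>) * f x \<partial>lborel \<partial>lborel)"
  proof (rule nn_integral_cong)
    fix s
    show "(\<integral>\<^sup>+x. h x * f (x + s *\<^sub>R \<theta>) \<partial>lborel) = (\<integral>\<^sup>+x. h (x - s *\<^sub>R \<theta>) * f x \<partial>lborel)"
      using nn_integral_lborel_translate[of "\<lambda>x. h (x - s *\<^sub>R \<theta>) * f x" "s *\<^sub>R \<theta>"] by simp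
  qed
  also have "\<dots> = (\<integral>\<^sup>+x. \<integral>\<^sup>+s. h (x - s *\<^sub>R \<theta>) * f x \<partial>lborel \<partial>lborel)"
    by (intro lborel_pair.Fubini') measurable
  also have "\<dots> = (\<integral>\<^sup>+x. f x \<partial>lborel)"
    by (simp add: nn_integral_multc h1)
  finally show ?thesis
    unfolding h_def ..
qed

subsection \<open>First variation along a segment\<close>

lemma nn_integral_continuous_mean_value:
  fixes G :: "real \<Rightarrow> real"
  assumes G: "continuous_on UNIV G" "\<And>x. G x \<ge> 0" and "c < d"
  obtains \<xi> where "\<xi> \<in> {c..d}"
    "(\<integral>\<^sup>+s. ennreal (G s) * indicator {c..d} s \<partial>lborel) = ennreal ((d - c) * G \<xi>)"
proof -
  have [measurable]: "G \<in> borel_measurable borel"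
    using G(1) by (rule borel_measurable_continuous_onI)
  \<comment> \<open>The interval is enlarged by \<open>1\<close> on each side so that
    \<open>F\<close> has a two-sided derivative at \<open>c\<close> and at \<open>d\<close>.\<close>
  obtain F where F: "\<And>x. x \<in> {c - 1..d + 1} \<Longrightarrow> (F has_vector_derivative G x) (at x within {c - 1..d + 1})"
    using antiderivative_continuous[of "c - 1" "d + 1" G] continuous_on_subset[OF G(1)] by blast
  have F_real: "(F has_real_derivative G x) (at x)" if "c \<le> x" "x \<le> d" for x
    using F[of x] that by (simp add: has_real_derivative_iff_has_vector_derivative at_within_Icc_at)
  obtain z where z: "c < z" "z < d" "F d - F c = (d - c) * G z"
    using MVT2[of c d F G] F_real \<open>c < d\<close> by auto
  have "(\<integral>\<^sup>+s. ennreal (G s) * indicator {c..d} s \<partial>lborel) = ennreal (F d - F c)"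
    using F_real G(2) \<open>c < d\<close> by (intro nn_integral_FTC_Icc) auto
  with z that[of z] show thesis
    by simp
qed

text \<open>The two intervals are what a thickening by \<open>\<delta>\<close> adds to a chord with
  parameters \<open>{a..b}\<close>. The mean values expose the factor \<open>\<delta>\<close>
  exactly, without an error term.\<close>

lemma nn_integral_half_open_intervals:
  fixes G :: "real \<Rightarrow> real"
  assumes G: "continuous_on UNIV G" "\<And>x. G x \<ge> 0" and ab: "a \<le> b" "\<delta> > 0"
  obtains \<xi> \<zeta> where "\<xi> \<in> {a - \<delta>..a}" "\<zeta> \<in> {b..b + \<delta>}"
    "(\<integral>\<^sup>+s. ennreal (G s) * indicator ({a - \<delta>..<a} \<union> {b<..b + \<delta>}) s \<partial>lborel)
      = ennreal (\<delta> * (G \<xi> + G \<zeta>))"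
proof -
  have [measurable]: "G \<in> borel_measurable borel"
    using G(1) by (rule borel_measurable_continuous_onI)
  obtain \<xi> where \<xi>: "\<xi> \<in> {a - \<delta>..a}"
    "(\<integral>\<^sup>+s. ennreal (G s) * indicator {a - \<delta>..a} s \<partial>lborel) = ennreal (\<delta> * G \<xi>)"
    using nn_integral_continuous_mean_value[OF G, of "a - \<delta>" a] ab by auto
  obtain \<zeta> where \<zeta>: "\<zeta> \<in> {b..b + \<delta>}"
    "(\<integral>\<^sup>+s. ennreal (G s) * indicator {b..b + \<delta>} s \<partial>lborel) = ennreal (\<delta> * G \<zeta>)"
    using nn_integral_continuous_mean_value[OF G, of b "b + \<delta>"] ab by auto
  have "(\<integral>\<^sup>+s. ennreal (G s) * indicator ({a - \<delta>..<a} \<union> {b<..b + \<delta>}) s \<partial>lborel)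
      = (\<integral>\<^sup>+s. ennreal (G s) * indicator {a - \<delta>..a} s + ennreal (G s) * indicator {b..b + \<delta>} s \<partial>lborel)"
  proof (rule nn_integral_cong_AE)
    show "AE s in lborel. ennreal (G s) * indicator ({a - \<delta>..<a} \<union> {b<..b + \<delta>}) s
        = ennreal (G s) * indicator {a - \<delta>..a} s + ennreal (G s) * indicator {b..b + \<delta>} s"
      using AE_lborel_singleton[of a] AE_lborel_singleton[of b]
    proof eventually_elim
      case (elim s)
      then show ?case
        using ab by (auto split: split_indicator)
    qed
  qed
  also have "\<dots> = ennreal (\<delta> * G \<xi>) + ennreal (\<delta> * G \<zeta>)"
    by (subst nn_integral_add) (auto simp: \<xi>(2) \<zeta>(2))
  also have "\<dots> = ennreal (\<delta> * (G \<xi> + G \<zeta>))"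
    using G(2) ab by (simp add: ennreal_plus[symmetric] distrib_left del: ennreal_plus)
  finally show thesis
    using that \<xi> \<zeta> by blast
qed

section \<open>Thickening by a segment, and chords parallel to it\<close>

lemma mem_plus_sym_segment:
  assumes "\<delta> > 0"
  shows "z \<in> L + (\<lambda>b. \<delta> *\<^sub>R b) ` sym_segment \<theta> \<longleftrightarrow> (\<exists>x\<in>L. \<exists>t. \<bar>t\<bar> \<le> \<delta> \<and> z = x + t *\<^sub>R \<theta>)"
proof
  assume "z \<in> L + (\<lambda>b. \<delta> *\<^sub>R b) ` sym_segment \<theta>"
  then obtain x t where "x \<in> L" "t \<in> {-1..1}" "z = x + \<delta> *\<^sub>R t *\<^sub>R \<theta>"
    by (auto simp: set_plus_def sym_segment_def)
  then show "\<exists>x\<in>L. \<exists>t. \<bar>t\<bar> \<le> \<delta> \<and> z = x + t *\<^sub>R \<theta>"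
    using assms by (intro bexI[of _ x] exI[of _ "\<delta> * t"]) (auto simp: abs_mult abs_le_iff)
next
  assume "\<exists>x\<in>L. \<exists>t. \<bar>t\<bar> \<le> \<delta> \<and> z = x + t *\<^sub>R \<theta>"
  then obtain x t where xt: "x \<in> L" "\<bar>t\<bar> \<le> \<delta>" "z = x + t *\<^sub>R \<theta>"
    by auto
  then have "t / \<delta> \<in> {-1..1}" "t *\<^sub>R \<theta> = \<delta> *\<^sub>R (t / \<delta>) *\<^sub>R \<theta>"
    using assms by (auto simp: field_simps abs_le_iff)
  with xt show "z \<in> L + (\<lambda>b. \<delta> *\<^sub>R b) ` sym_segment \<theta>"
    unfolding set_plus_def sym_segment_def by blast
qed

lemma plus_sym_segment_superset:
  "\<delta> > 0 \<Longrightarrow> L \<subseteq> L + (\<lambda>b. \<delta> *\<^sub>R b) ` sym_segment \<theta>"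
  by (auto simp: mem_plus_sym_segment intro!: bexI exI[of _ 0])

lemma compact_sym_segment: "compact (sym_segment \<theta>)"
proof -
  have "sym_segment \<theta> = (\<lambda>t. t *\<^sub>R \<theta>) ` {-1..1}"
    by (auto simp: sym_segment_def)
  then show ?thesis
    by (auto intro!: compact_continuous_image continuous_intros)
qed

lemma convex_sym_segment: "convex (sym_segment \<theta>)"
proof -
  have "sym_segment \<theta> = (\<lambda>t. t *\<^sub>R \<theta>) ` {-1..1}"
    by (auto simp: sym_segment_def)
  then show ?thesis
    by (auto intro!: convex_linear_image bounded_linear.linear bounded_linear_scaleR_left)
qed

lemma compact_set_plus:
  fixes A B :: "'a::real_normed_vector set"
  shows "compact A \<Longrightarrow> compact B \<Longrightarrow> compact (A + B)"
  unfolding set_plus_image split_def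
  by (intro compact_continuous_image compact_Times continuous_intros)

text \<open>The chord of \<open>K\<close> on the line through \<open>y\<close> in direction
  \<open>\<theta>\<close>, as a set of reals. The base point \<open>y\<close> may be any point of
  the line; moving it along \<open>\<theta>\<close> shifts the set.\<close>

definition line_params :: "'a::real_vector set \<Rightarrow> 'a \<Rightarrow> 'a \<Rightarrow> real set" where
  "line_params K \<theta> y = {s. y + s *\<^sub>R \<theta> \<in> K}"

lemma compact_line_params:
  fixes \<theta> :: "'a::euclidean_space"
  assumes "compact K" "norm \<theta> = 1"
  shows "compact (line_params K \<theta> y)"
proof -
  have "closed (line_params K \<theta> y)"
  proof -
    have "continuous_on UNIV (\<lambda>s. y + s *\<^sub>R \<theta>)"
      by (intro continuous_intros)
    then have "closed ((\<lambda>s. y + s *\<^sub>R \<theta>) -` K)"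
      by (rule closed_vimage[OF compact_imp_closed[OF assms(1)]])
    then show ?thesis
      by (simp add: line_params_def vimage_def)
  qed
  moreover obtain R where R: "\<And>x. x \<in> K \<Longrightarrow> norm x \<le> R"
    using compact_imp_bounded[OF assms(1)] by (auto simp: bounded_iff)
  have "\<bar>s\<bar> \<le> R + norm y" if "s \<in> line_params K \<theta> y" for s
  proof -
    have "norm (s *\<^sub>R \<theta>) \<le> norm (y + s *\<^sub>R \<theta>) + norm y"
      using norm_triangle_ineq4[of "y + s *\<^sub>R \<theta>" y] by simp
    then show ?thesis
      using R[of "y + s *\<^sub>R \<theta>"] that assms(2) by (auto simp: line_params_def)
  qed
  then have "bounded (line_params K \<theta> y)"
    by (auto simp: bounded_iff)
  ultimately show ?thesis
    by (simp add: compact_eq_bounded_closed)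
qed

lemma convex_line_params:
  assumes "convex K"
  shows "convex (line_params K \<theta> y)"
proof (rule convexI)
  fix s t u v :: real
  assume st: "s \<in> line_params K \<theta> y" "t \<in> line_params K \<theta> y" and uv: "0 \<le> u" "0 \<le> v" "u + v = 1"
  then have "u *\<^sub>R (y + s *\<^sub>R \<theta>) + v *\<^sub>R (y + t *\<^sub>R \<theta>) \<in> K"
    using convexD[OF assms] by (simp add: line_params_def)
  also have "u *\<^sub>R (y + s *\<^sub>R \<theta>) + v *\<^sub>R (y + t *\<^sub>R \<theta>) = (u + v) *\<^sub>R y + (u * s + v * t) *\<^sub>R \<theta>"
    by (simp add: algebra_simps)
  finally show "u *\<^sub>R s + v *\<^sub>R t \<in> line_params K \<theta> y"
    using uv by (simp add: line_params_def)
qed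

lemma line_params_interval:
  fixes \<theta> :: "'a::euclidean_space"
  assumes K: "compact K" "convex K" and \<theta>: "norm \<theta> = 1" and ne: "line_params K \<theta> y \<noteq> {}"
  shows "line_params K \<theta> y = {Inf (line_params K \<theta> y)..Sup (line_params K \<theta> y)}"
    and "Inf (line_params K \<theta> y) \<le> Sup (line_params K \<theta> y)"
proof -
  let ?S = "line_params K \<theta> y"
  have S: "compact ?S" "is_interval ?S"
    using compact_line_params[OF K(1) \<theta>] convex_line_params[OF K(2)] by (simp_all add: is_interval_convex_1)
  have "closed ?S" "bounded ?S"
    using S(1) compact_imp_closed compact_imp_bounded by blast+
  then have "bdd_above ?S" "bdd_below ?S"
    by (simp_all add: bounded_imp_bdd_above bounded_imp_bdd_below)
  then have 1: "Inf ?S \<in> ?S" "Sup ?S \<in> ?S"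
    using ne \<open>closed ?S\<close> by (simp_all add: closed_contains_Inf closed_contains_Sup)
  show "?S = {Inf ?S..Sup ?S}"
  proof (intro equalityI subsetI)
    fix x assume "x \<in> ?S" then show "x \<in> {Inf ?S..Sup ?S}"
      using \<open>bdd_above ?S\<close> \<open>bdd_below ?S\<close> by (auto intro: cInf_lower cSup_upper)
  next
    fix x assume "x \<in> {Inf ?S..Sup ?S}" then show "x \<in> ?S"
      using mem_is_interval_1_I[OF S(2) 1] by simp
  qed
  show "Inf ?S \<le> Sup ?S"
    using 1(2) \<open>bdd_below ?S\<close> by (rule cInf_lower)
qed

text \<open>Adding multiples of \<open>\<theta>\<close> acts within each line parallel to
  \<open>\<theta>\<close>: a chord grows by \<open>\<delta>\<close> at both ends, and a line missing
  \<open>L\<close> stays missed.\<close>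

lemma line_params_shell:
  fixes \<theta> :: "real^'n"
  assumes L: "compact L" "convex L" and \<theta>: "norm \<theta> = 1" and \<delta>: "\<delta> > 0"
  defines "D \<equiv> (L + (\<lambda>b. \<delta> *\<^sub>R b) ` sym_segment \<theta>) - L"
  shows "line_params L \<theta> y = {} \<Longrightarrow> line_params D \<theta> y = {}"
    and "line_params L \<theta> y \<noteq> {} \<Longrightarrow> line_params D \<theta> y
      = {Inf (line_params L \<theta> y) - \<delta>..<Inf (line_params L \<theta> y)}
        \<union> {Sup (line_params L \<theta> y)<..Sup (line_params L \<theta> y) + \<delta>}"
proof -
  have mem: "s \<in> line_params D \<theta> y \<longleftrightarrow>
      s \<notin> line_params L \<theta> y \<and> (\<exists>r\<in>line_params L \<theta> y. \<bar>s - r\<bar> \<le> \<delta>)" for s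
  proof -
    have "y + s *\<^sub>R \<theta> \<in> L + (\<lambda>b. \<delta> *\<^sub>R b) ` sym_segment \<theta>
        \<longleftrightarrow> (\<exists>r\<in>line_params L \<theta> y. \<bar>s - r\<bar> \<le> \<delta>)"
      unfolding mem_plus_sym_segment[OF \<delta>]
    proof safe
      fix x t assume "x \<in> L" "\<bar>t\<bar> \<le> \<delta>" "y + s *\<^sub>R \<theta> = x + t *\<^sub>R \<theta>"
      moreover from this have "x = y + (s - t) *\<^sub>R \<theta>"
        by (simp add: algebra_simps)
      ultimately show "\<exists>r\<in>line_params L \<theta> y. \<bar>s - r\<bar> \<le> \<delta>"
        by (intro bexI[of _ "s - t"]) (auto simp: line_params_def)
    next
      fix r assume "r \<in> line_params L \<theta> y" "\<bar>s - r\<bar> \<le> \<delta>"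
      then show "\<exists>x\<in>L. \<exists>t. \<bar>t\<bar> \<le> \<delta> \<and> y + s *\<^sub>R \<theta> = x + t *\<^sub>R \<theta>"
        by (intro bexI[of _ "y + r *\<^sub>R \<theta>"] exI[of _ "s - r"]) (auto simp: line_params_def algebra_simps)
    qed
    then show ?thesis
      by (auto simp: D_def line_params_def)
  qed
  show "line_params D \<theta> y = {}" if "line_params L \<theta> y = {}"
    using mem that by auto
  show "line_params D \<theta> y
      = {Inf (line_params L \<theta> y) - \<delta>..<Inf (line_params L \<theta> y)}
        \<union> {Sup (line_params L \<theta> y)<..Sup (line_params L \<theta> y) + \<delta>}"
    if "line_params L \<theta> y \<noteq> {}"
  proof -
    define a b where "a = Inf (line_params L \<theta> y)" and "b = Sup (line_params L \<theta> y)"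
    have ab: "line_params L \<theta> y = {a..b}" "a \<le> b"
      using line_params_interval[OF L \<theta> that] unfolding a_def b_def by auto
    have "s \<in> line_params D \<theta> y \<longleftrightarrow> s \<in> {a - \<delta>..<a} \<union> {b<..b + \<delta>}" for s
    proof
      assume "s \<in> {a - \<delta>..<a} \<union> {b<..b + \<delta>}"
      then have "\<bar>s - a\<bar> \<le> \<delta> \<or> \<bar>s - b\<bar> \<le> \<delta>" "s \<notin> {a..b}"
        using ab by auto
      with ab show "s \<in> line_params D \<theta> y"
        unfolding mem by auto
    qed (auto simp: mem ab)
    then show ?thesis
      unfolding a_def b_def by blast
  qed
qed

lemma line_params_separated:
  fixes \<theta> :: "'a::euclidean_space"
  assumes K: "compact K" and \<theta>: "norm \<theta> = 1" and C: "closed C" "C \<inter> line_params K \<theta> y = {}"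
  obtains d where "d > 0" "\<And>s x. s \<in> C \<Longrightarrow> x \<in> K \<Longrightarrow> d \<le> dist x (y + s *\<^sub>R \<theta>)"
proof -
  \<comment> \<open>\<open>H\<close> consists of the points \<open>y + s *\<^sub>R \<theta>\<close>
    with \<open>s \<in> C\<close>; as an intersection of preimages it is visibly closed, so it has
    positive distance from the compact \<open>K\<close>.\<close>
  define H where "H = (\<lambda>z. z - y - ((z - y) \<bullet> \<theta>) *\<^sub>R \<theta>) -` {0} \<inter> (\<lambda>z. (z - y) \<bullet> \<theta>) -` C"
  have "closed H"
    unfolding H_def using C(1)
    by (intro closed_Int closed_vimage continuous_intros) auto
  have inH: "y + s *\<^sub>R \<theta> \<in> H" if "s \<in> C" for s
    using that \<theta> by (simp add: H_def dot_square_norm)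
  have "K \<inter> H = {}"
  proof (rule ccontr)
    assume "K \<inter> H \<noteq> {}"
    then obtain z where z: "z \<in> K" "z - y = ((z - y) \<bullet> \<theta>) *\<^sub>R \<theta>" "(z - y) \<bullet> \<theta> \<in> C"
      by (auto simp: H_def)
    have "y + ((z - y) \<bullet> \<theta>) *\<^sub>R \<theta> = z"
      using z(2) by (metis add.commute diff_add_cancel)
    then have "(z - y) \<bullet> \<theta> \<in> C \<inter> line_params K \<theta> y"
      using z by (simp add: line_params_def)
    then show False
      using C(2) by blast
  qed
  then obtain d where "d > 0" "\<And>x z. x \<in> K \<Longrightarrow> z \<in> H \<Longrightarrow> d \<le> dist x z"
    using separate_compact_closed[OF K \<open>closed H\<close>] by metis
  then show thesis
    using that inH by blast
qed

text \<open>Used with \<open>C = UNIV\<close> for lines that miss \<open>K\<close>, and with the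
  rays \<open>{..c}\<close> and \<open>{c..}\<close> to control the ends of chords.\<close>

lemma eventually_line_params_disjoint:
  fixes \<theta> :: "'a::euclidean_space"
  assumes K: "compact K" and \<theta>: "norm \<theta> = 1" and C: "closed C" "C \<inter> line_params K \<theta> y = {}"
    and L: "\<And>k z. z \<in> L k \<Longrightarrow> \<exists>x\<in>K. dist x z \<le> \<eta> k" and \<eta>: "\<eta> \<longlonglongrightarrow> 0"
  shows "\<forall>\<^sub>F k in sequentially. C \<inter> line_params (L k) \<theta> y = {}"
proof -
  obtain d where d: "d > 0" "\<And>s x. s \<in> C \<Longrightarrow> x \<in> K \<Longrightarrow> d \<le> dist x (y + s *\<^sub>R \<theta>)"
    using line_params_separated[OF K \<theta> C] by metis
  have "\<forall>\<^sub>F k in sequentially. \<eta> k < d"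
    using order_tendstoD(2)[OF \<eta> d(1)] .
  then show ?thesis
  proof eventually_elim
    case (elim k)
    have False if s: "s \<in> C" "y + s *\<^sub>R \<theta> \<in> L k" for s
    proof -
      obtain x where "x \<in> K" "dist x (y + s *\<^sub>R \<theta>) \<le> \<eta> k"
        using L[OF s(2)] by auto
      then show False
        using d(2)[OF s(1), of x] elim by linarith
    qed
    then show ?case
      by (auto simp: line_params_def)
  qed
qed

text \<open>The inclusion \<open>K \<subseteq> L k\<close> gives one side of each limit at once; the
  other follows by separating \<open>K\<close> from the part of the line beyond the chord. For
  approximation from inside, a chord on a line that merely touches \<open>K\<close> could
  disappear.\<close>

lemma tendsto_line_params_ends:
  fixes \<theta> :: "'a::euclidean_space"
  assumes K: "compact K" "convex K" and \<theta>: "norm \<theta> = 1" and ne: "line_params K \<theta> y \<noteq> {}"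
    and KL: "\<And>k. K \<subseteq> L k" and cL: "\<And>k. compact (L k)" "\<And>k. convex (L k)"
    and L: "\<And>k z. z \<in> L k \<Longrightarrow> \<exists>x\<in>K. dist x z \<le> \<eta> k" and \<eta>: "\<eta> \<longlonglongrightarrow> 0"
  shows "(\<lambda>k. Inf (line_params (L k) \<theta> y)) \<longlonglongrightarrow> Inf (line_params K \<theta> y)"
    and "(\<lambda>k. Sup (line_params (L k) \<theta> y)) \<longlonglongrightarrow> Sup (line_params K \<theta> y)"
proof -
  define a b where "a = Inf (line_params K \<theta> y)" and "b = Sup (line_params K \<theta> y)"
  define A B where "A = (\<lambda>k. Inf (line_params (L k) \<theta> y))" and "B = (\<lambda>k. Sup (line_params (L k) \<theta> y))"
  have ab: "line_params K \<theta> y = {a..b}" "a \<le> b"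
    using line_params_interval[OF K \<theta> ne] unfolding a_def b_def by auto
  have sub: "line_params K \<theta> y \<subseteq> line_params (L k) \<theta> y" for k
    using KL[of k] by (auto simp: line_params_def)
  then have neL: "line_params (L k) \<theta> y \<noteq> {}" for k
    using ne by blast
  have AB: "line_params (L k) \<theta> y = {A k..B k}" "A k \<le> B k" for k
    using line_params_interval[OF cL \<theta> neL] unfolding A_def B_def by auto
  have le: "A k \<le> a" "b \<le> B k" for k
    using sub[of k] ab AB by auto
  have "A \<longlonglongrightarrow> a"
  proof (rule order_tendstoI)
    fix c assume "c < a"
    then have "\<forall>\<^sub>F k in sequentially. {..c} \<inter> line_params (L k) \<theta> y = {}"
      using ab by (intro eventually_line_params_disjoint[OF K(1) \<theta> _ _ L \<eta>]) auto
    then show "\<forall>\<^sub>F k in sequentially. c < A k"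
    proof eventually_elim
      case (elim k)
      have "A k \<in> line_params (L k) \<theta> y"
        by (simp add: AB)
      with elim show ?case
        by (metis IntI atMost_iff empty_iff not_le)
    qed
  next
    fix c assume "a < c"
    then show "\<forall>\<^sub>F k in sequentially. A k < c"
      using le(1) by (intro always_eventually allI) (rule le_less_trans)
  qed
  moreover have "B \<longlonglongrightarrow> b"
  proof (rule order_tendstoI)
    fix c assume "b < c"
    then have "\<forall>\<^sub>F k in sequentially. {c..} \<inter> line_params (L k) \<theta> y = {}"
      using ab by (intro eventually_line_params_disjoint[OF K(1) \<theta> _ _ L \<eta>]) auto
    then show "\<forall>\<^sub>F k in sequentially. B k < c"
    proof eventually_elim
      case (elim k)
      have "B k \<in> line_params (L k) \<theta> y"
        by (simp add: AB)
      with elim show ?case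
        by (metis IntI atLeast_iff empty_iff not_le)
    qed
  next
    fix c assume "c < b"
    then show "\<forall>\<^sub>F k in sequentially. c < B k"
      using le(2) by (intro always_eventually allI) (rule less_le_trans)
  qed
  ultimately show "(\<lambda>k. Inf (line_params (L k) \<theta> y)) \<longlonglongrightarrow> Inf (line_params K \<theta> y)"
    and "(\<lambda>k. Sup (line_params (L k) \<theta> y)) \<longlonglongrightarrow> Sup (line_params K \<theta> y)"
    unfolding A_def B_def a_def b_def by auto
qed

text \<open>Per line, the difference quotient is exactly a sum of two values of \<open>g\<close>
  within \<open>\<delta>\<close> of the ends of the chord. This form serves both the pointwise limit
  and the uniform bound in dominated convergence.\<close>

lemma shell_line_integral:
  fixes g :: "real^'n \<Rightarrow> real"
  assumes g: "continuous_on UNIV g" "\<And>x. g x \<ge> 0"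
    and L: "compact L" "convex L" and \<theta>: "norm \<theta> = 1" and \<delta>: "\<delta> > 0"
  defines "D \<equiv> (L + (\<lambda>b. \<delta> *\<^sub>R b) ` sym_segment \<theta>) - L"
  defines "I \<equiv> \<lambda>y. (\<integral>\<^sup>+s. ennreal (g (y + s *\<^sub>R \<theta>)) * indicator D (y + s *\<^sub>R \<theta>) \<partial>lborel) / ennreal \<delta>"
  shows "line_params L \<theta> y = {} \<Longrightarrow> I y = 0"
    and "line_params L \<theta> y \<noteq> {} \<Longrightarrow>
      \<exists>\<xi>\<in>{Inf (line_params L \<theta> y) - \<delta>..Inf (line_params L \<theta> y)}.
      \<exists>\<zeta>\<in>{Sup (line_params L \<theta> y)..Sup (line_params L \<theta> y) + \<delta>}.
        I y = ennreal (g (y + \<xi> *\<^sub>R \<theta>) + g (y + \<zeta> *\<^sub>R \<theta>))"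
proof -
  have I: "I y = (\<integral>\<^sup>+s. ennreal (g (y + s *\<^sub>R \<theta>)) * indicator (line_params D \<theta> y) s \<partial>lborel) / ennreal \<delta>"
    unfolding I_def by (simp add: line_params_def indicator_def)
  show "I y = 0" if "line_params L \<theta> y = {}"
    unfolding I using line_params_shell(1)[OF L \<theta> \<delta> that] by (simp add: D_def)
  assume ne: "line_params L \<theta> y \<noteq> {}"
  have "continuous_on UNIV (\<lambda>s. g (y + s *\<^sub>R \<theta>))"
    by (intro continuous_on_compose2[OF g(1)] continuous_intros) auto
  then obtain \<xi> \<zeta> where *: "\<xi> \<in> {Inf (line_params L \<theta> y) - \<delta>..Inf (line_params L \<theta> y)}"
      "\<zeta> \<in> {Sup (line_params L \<theta> y)..Sup (line_params L \<theta> y) + \<delta>}"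
      "(\<integral>\<^sup>+s. ennreal (g (y + s *\<^sub>R \<theta>)) * indicator (line_params D \<theta> y) s \<partial>lborel)
        = ennreal (\<delta> * (g (y + \<xi> *\<^sub>R \<theta>) + g (y + \<zeta> *\<^sub>R \<theta>)))"
    unfolding D_def line_params_shell(2)[OF L \<theta> \<delta> ne]
    using nn_integral_half_open_intervals[OF _ _ line_params_interval(2)[OF L \<theta> ne] \<delta>,
        of "\<lambda>s. g (y + s *\<^sub>R \<theta>)"] g(2) by blast
  have "I y = ennreal (g (y + \<xi> *\<^sub>R \<theta>) + g (y + \<zeta> *\<^sub>R \<theta>))"
    unfolding I *(3) using \<delta> g(2) by (simp add: divide_ennreal)
  with *(1,2) show "\<exists>\<xi>\<in>{Inf (line_params L \<theta> y) - \<delta>..Inf (line_params L \<theta> y)}.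
      \<exists>\<zeta>\<in>{Sup (line_params L \<theta> y)..Sup (line_params L \<theta> y) + \<delta>}.
        I y = ennreal (g (y + \<xi> *\<^sub>R \<theta>) + g (y + \<zeta> *\<^sub>R \<theta>))"
    by blast
qed

text \<open>For a convex body this is the boundary integral of \<open>g\<close> weighted by the
  absolute inner product of \<open>\<theta>\<close> with the unit normal. The slab meets each line
  parallel to \<open>\<theta>\<close> in length \<open>1\<close> and so stands for the projection
  along \<open>\<theta>\<close>. Missed lines are set to \<open>0\<close>, since \<open>Inf\<close>
  and \<open>Sup\<close> of the empty set carry no meaning.\<close>

definition boundary_flux :: "(real^'n \<Rightarrow> real) \<Rightarrow> (real^'n) set \<Rightarrow> real^'n \<Rightarrow> ennreal" where
  "boundary_flux g K \<theta> = (\<integral>\<^sup>+y. indicator {y. 0 \<le> y \<bullet> \<theta> \<and> y \<bullet> \<theta> < 1} y *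
     (if line_params K \<theta> y = {} then 0
      else ennreal (g (y + Inf (line_params K \<theta> y) *\<^sub>R \<theta>) + g (y + Sup (line_params K \<theta> y) *\<^sub>R \<theta>))) \<partial>lborel)"

lemma norm_slab_point_le:
  fixes \<theta> :: "'a::euclidean_space"
  assumes \<theta>: "norm \<theta> = 1" and y: "0 \<le> y \<bullet> \<theta>" "y \<bullet> \<theta> < 1" and R: "norm (y + s *\<^sub>R \<theta>) \<le> R"
  shows "norm y \<le> 2 * R + 1"
proof -
  have "(y + s *\<^sub>R \<theta>) \<bullet> \<theta> = y \<bullet> \<theta> + s"
    using \<theta> by (simp add: inner_add_left dot_square_norm)
  moreover have "\<bar>(y + s *\<^sub>R \<theta>) \<bullet> \<theta>\<bar> \<le> R"
    using Cauchy_Schwarz_ineq2[of "y + s *\<^sub>R \<theta>" \<theta>] \<theta> R by simp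
  ultimately have "\<bar>s\<bar> \<le> R + 1"
    using y by linarith
  moreover have "norm y \<le> norm (y + s *\<^sub>R \<theta>) + \<bar>s\<bar>"
    using norm_triangle_ineq4[of "y + s *\<^sub>R \<theta>" "s *\<^sub>R \<theta>"] \<theta> by simp
  ultimately show ?thesis
    using R by linarith
qed

text \<open>The sets \<open>L k\<close> vary so that the segments of a box can be added one after the other. As they
  approach \<open>K\<close> from outside, lines that only touch \<open>K\<close> need no separate treatment.\<close>
theorem first_variation_sym_segment:
  fixes g :: "real^'n \<Rightarrow> real"
  assumes g: "continuous_on UNIV g" "\<And>x. g x \<ge> 0"
    and K: "compact K" "convex K" and \<theta>: "norm \<theta> = 1"
    and KL: "\<And>k. K \<subseteq> L k" and cL: "\<And>k. compact (L k)" "\<And>k. convex (L k)"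
    and L: "\<And>k z. z \<in> L k \<Longrightarrow> \<exists>x\<in>K. dist x z \<le> \<eta> k" and \<eta>: "\<eta> \<longlonglongrightarrow> 0"
    and \<delta>: "\<And>k. \<delta> k > 0" "\<delta> \<longlonglongrightarrow> 0"
  shows "(\<lambda>k. emeasure (density lborel (\<lambda>x. ennreal (g x)))
             ((L k + (\<lambda>b. \<delta> k *\<^sub>R b) ` sym_segment \<theta>) - L k) / ennreal (\<delta> k))
           \<longlonglongrightarrow> boundary_flux g K \<theta>" (is "?lim")
    and "boundary_flux g K \<theta> < top"
proof -
  define D where "D = (\<lambda>k. (L k + (\<lambda>b. \<delta> k *\<^sub>R b) ` sym_segment \<theta>) - L k)"
  define I where "I = (\<lambda>k y. (\<integral>\<^sup>+s. ennreal (g (y + s *\<^sub>R \<theta>)) * indicator (D k) (y + s *\<^sub>R \<theta>) \<partial>lborel)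
      / ennreal (\<delta> k))"
  define S where "S = {y. 0 \<le> y \<bullet> \<theta> \<and> y \<bullet> \<theta> < 1}"
  define \<beta> where "\<beta> = (\<lambda>y. if line_params K \<theta> y = {} then 0
    else ennreal (g (y + Inf (line_params K \<theta> y) *\<^sub>R \<theta>) + g (y + Sup (line_params K \<theta> y) *\<^sub>R \<theta>)))"
  have S [measurable]: "S \<in> sets borel"
    unfolding S_def by measurable
  have D [measurable]: "D k \<in> sets borel" for k
    unfolding D_def
    by (intro sets.Diff borel_compact compact_set_plus compact_scaling compact_sym_segment cL)
  have [measurable]: "g \<in> borel_measurable borel"
    using g(1) by (rule borel_measurable_continuous_onI)
  have flux: "boundary_flux g K \<theta> = (\<integral>\<^sup>+y. indicator S y * \<beta> y \<partial>lborel)"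
    by (simp add: boundary_flux_def S_def \<beta>_def)
  have meas: "emeasure (density lborel (\<lambda>x. ennreal (g x))) (D k) / ennreal (\<delta> k)
      = (\<integral>\<^sup>+y. indicator S y * I k y \<partial>lborel)" for k
  proof -
    have "emeasure (density lborel (\<lambda>x. ennreal (g x))) (D k)
        = (\<integral>\<^sup>+x. ennreal (g x) * indicator (D k) x \<partial>lborel)"
      by (subst emeasure_density) auto
    also have "\<dots> = (\<integral>\<^sup>+y. indicator S y *
        (\<integral>\<^sup>+s. ennreal (g (y + s *\<^sub>R \<theta>)) * indicator (D k) (y + s *\<^sub>R \<theta>) \<partial>lborel) \<partial>lborel)"
      unfolding S_def using \<theta> by (intro nn_integral_lborel_slab) (auto simp: dot_square_norm)
    also have "\<dots> / ennreal (\<delta> k) = (\<integral>\<^sup>+y. indicator S y *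
        (\<integral>\<^sup>+s. ennreal (g (y + s *\<^sub>R \<theta>)) * indicator (D k) (y + s *\<^sub>R \<theta>) \<partial>lborel) / ennreal (\<delta> k) \<partial>lborel)"
      by (intro nn_integral_divide[symmetric]) measurable
    finally show ?thesis
      by (simp add: I_def ennreal_times_divide)
  qed
  have I_meas [measurable]: "I k \<in> borel_measurable borel" for k
    unfolding I_def by measurable
  have sub: "line_params K \<theta> y \<subseteq> line_params (L k) \<theta> y" for k y
    using KL[of k] by (auto simp: line_params_def)
  have lim: "(\<lambda>k. I k y) \<longlonglongrightarrow> \<beta> y" for y
  proof (cases "line_params K \<theta> y = {}")
    case True
    have "\<forall>\<^sub>F k in sequentially. UNIV \<inter> line_params (L k) \<theta> y = {}"
      using True by (intro eventually_line_params_disjoint[OF K(1) \<theta> _ _ L \<eta>]) auto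
    then have "\<forall>\<^sub>F k in sequentially. I k y = 0"
      by eventually_elim
        (use shell_line_integral(1)[OF g cL \<theta> \<delta>(1)] in \<open>simp add: I_def D_def\<close>)
    then show ?thesis
      using True by (simp add: \<beta>_def tendsto_eventually)
  next
    case False
    define A B where "A = (\<lambda>k. Inf (line_params (L k) \<theta> y))" and "B = (\<lambda>k. Sup (line_params (L k) \<theta> y))"
    have AB: "A \<longlonglongrightarrow> Inf (line_params K \<theta> y)" "B \<longlonglongrightarrow> Sup (line_params K \<theta> y)"
      unfolding A_def B_def using tendsto_line_params_ends[OF K \<theta> False KL cL L \<eta>] by auto
    have ne: "line_params (L k) \<theta> y \<noteq> {}" for k
      using False sub[of y k] by blast
    have "\<forall>k. \<exists>\<xi> \<zeta>. \<xi> \<in> {A k - \<delta> k..A k} \<and> \<zeta> \<in> {B k..B k + \<delta> k} \<and>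
        I k y = ennreal (g (y + \<xi> *\<^sub>R \<theta>) + g (y + \<zeta> *\<^sub>R \<theta>))"
      using shell_line_integral(2)[OF g cL \<theta> \<delta>(1) ne] unfolding A_def B_def I_def D_def by blast
    then obtain \<xi> \<zeta> where \<xi>: "\<And>k. \<xi> k \<in> {A k - \<delta> k..A k}" and \<zeta>: "\<And>k. \<zeta> k \<in> {B k..B k + \<delta> k}"
      and I: "\<And>k. I k y = ennreal (g (y + \<xi> k *\<^sub>R \<theta>) + g (y + \<zeta> k *\<^sub>R \<theta>))"
      by metis
    have "\<xi> \<longlonglongrightarrow> Inf (line_params K \<theta> y)"
    proof (rule tendsto_sandwich)
      show "(\<lambda>k. A k - \<delta> k) \<longlonglongrightarrow> Inf (line_params K \<theta> y)"
        using tendsto_diff[OF AB(1) \<delta>(2)] by simp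
    qed (use \<xi> AB(1) in auto)
    moreover have "\<zeta> \<longlonglongrightarrow> Sup (line_params K \<theta> y)"
    proof (rule tendsto_sandwich[of B _ _ "\<lambda>k. B k + \<delta> k"])
      show "(\<lambda>k. B k + \<delta> k) \<longlonglongrightarrow> Sup (line_params K \<theta> y)"
        using tendsto_add[OF AB(2) \<delta>(2)] by simp
    qed (use \<zeta> AB(2) in auto)
    ultimately have "(\<lambda>k. g (y + \<xi> k *\<^sub>R \<theta>) + g (y + \<zeta> k *\<^sub>R \<theta>))
        \<longlonglongrightarrow> g (y + Inf (line_params K \<theta> y) *\<^sub>R \<theta>) + g (y + Sup (line_params K \<theta> y) *\<^sub>R \<theta>)"
      by (intro tendsto_add continuous_on_tendsto_compose[OF g(1)] tendsto_intros) auto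
    then show ?thesis
      unfolding I using False by (simp add: \<beta>_def tendsto_ennrealI)
  qed
  \<comment> \<open>As a pointwise limit of measurable functions \<open>\<beta>\<close> is
    measurable; the dependence of the chord ends on \<open>y\<close> need not be examined.\<close>
  have \<beta>_meas [measurable]: "\<beta> \<in> borel_measurable borel"
    by (rule borel_measurable_LIMSEQ_order[OF lim I_meas])
  obtain R0 where R0: "\<And>x. x \<in> K \<Longrightarrow> norm x \<le> R0"
    using compact_imp_bounded[OF K(1)] by (auto simp: bounded_iff)
  obtain E where E: "\<And>k. \<bar>\<eta> k\<bar> \<le> E"
    using convergent_imp_Bseq[OF convergentI[OF \<eta>]] by (auto simp: Bseq_def)
  obtain F where F: "\<And>k. \<bar>\<delta> k\<bar> \<le> F"
    using convergent_imp_Bseq[OF convergentI[OF \<delta>(2)]] by (auto simp: Bseq_def)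
  define R where "R = R0 + E + F"
  have R_L: "norm (z + t *\<^sub>R \<theta>) \<le> R" if z: "z \<in> L k" and t: "\<bar>t\<bar> \<le> \<delta> k" for k z t
  proof -
    obtain x where x: "x \<in> K" "dist x z \<le> \<eta> k"
      using L[OF z] by auto
    have "norm (z + t *\<^sub>R \<theta>) \<le> norm x + dist x z + \<bar>t\<bar>"
      using norm_triangle_ineq[of z "t *\<^sub>R \<theta>"] norm_triangle_sub[of z x] \<theta>
      by (simp add: dist_norm norm_minus_commute)
    then show ?thesis
      using R0[OF x(1)] x(2) E[of k] F[of k] t by (simp add: R_def)
  qed
  obtain G where G: "\<And>x. norm x \<le> R \<Longrightarrow> g x \<le> G"
  proof -
    have "compact (g ` cball 0 R)"
      by (intro compact_continuous_image continuous_on_subset[OF g(1)]) auto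
    from compact_imp_bounded[OF this] obtain G where "\<forall>z\<in>g ` cball 0 R. norm z \<le> G"
      unfolding bounded_iff ..
    then have "g x \<le> G" if "norm x \<le> R" for x
      using that by (simp add: abs_le_iff)
    then show thesis
      by (rule that)
  qed
  \<comment> \<open>\<open>R\<close> bounds every thickened set \<open>L k\<close> and
    \<open>G\<close> bounds \<open>g\<close> on that ball. The factor \<open>2\<close> counts the
    two ends, and \<open>2 * R + 1\<close> is the radius from
    \<open>norm_slab_point_le\<close>.\<close>
  define W where "W = (\<lambda>y::real^'n. ennreal (2 * G) * indicator (cball 0 (2 * R + 1)) y)"
  have [measurable]: "cball (0::real^'n) (2 * R + 1) \<in> sets borel"
    by (intro borel_closed) auto
  have W_meas [measurable]: "W \<in> borel_measurable borel"
    unfolding W_def by measurable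
  have bound: "indicator S y * I k y \<le> W y" for k y
  proof (cases "y \<in> S \<and> line_params (L k) \<theta> y \<noteq> {}")
    case True
    define a b where "a = Inf (line_params (L k) \<theta> y)" and "b = Sup (line_params (L k) \<theta> y)"
    have ab: "line_params (L k) \<theta> y = {a..b}" "a \<le> b"
      using line_params_interval[OF cL(1)[of k] cL(2)[of k] \<theta>, where y = y] True unfolding a_def b_def by auto
    then have "a \<in> line_params (L k) \<theta> y" "b \<in> line_params (L k) \<theta> y"
      by auto
    then have inL: "y + a *\<^sub>R \<theta> \<in> L k" "y + b *\<^sub>R \<theta> \<in> L k"
      by (auto simp: line_params_def)
    obtain \<xi> \<zeta> where \<xi>: "\<xi> \<in> {a - \<delta> k..a}" and \<zeta>: "\<zeta> \<in> {b..b + \<delta> k}"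
      and I: "I k y = ennreal (g (y + \<xi> *\<^sub>R \<theta>) + g (y + \<zeta> *\<^sub>R \<theta>))"
      using shell_line_integral(2)[OF g cL(1)[of k] cL(2)[of k] \<theta> \<delta>(1)[of k], where y = y] True unfolding a_def b_def I_def D_def by blast
    have "norm (y + \<xi> *\<^sub>R \<theta>) \<le> R" "norm (y + \<zeta> *\<^sub>R \<theta>) \<le> R"
      using R_L[OF inL(1), of "\<xi> - a"] R_L[OF inL(2), of "\<zeta> - b"] \<xi> \<zeta> by (simp_all add: algebra_simps)
    then have "I k y \<le> ennreal (2 * G)"
      unfolding I using G[of "y + \<xi> *\<^sub>R \<theta>"] G[of "y + \<zeta> *\<^sub>R \<theta>"] by (intro ennreal_leI) simp
    moreover have "y \<in> cball 0 (2 * R + 1)"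
      using norm_slab_point_le[OF \<theta>, of y a R] R_L[OF inL(1), of 0] \<delta>(1)[of k] True
      by (simp add: S_def)
    ultimately show ?thesis
      using True by (simp add: W_def)
  next
    case False
    then have "y \<notin> S \<or> I k y = 0"
      using shell_line_integral(1)[OF g cL(1)[of k] cL(2)[of k] \<theta> \<delta>(1)[of k], where y = y]
      by (auto simp: I_def D_def)
    then show ?thesis
      by auto
  qed
  have W_fin: "(\<integral>\<^sup>+y. W y \<partial>lborel) < top"
    unfolding W_def using emeasure_lborel_cball_finite[of "0::real^'n" "2 * R + 1"]
    by (simp add: nn_integral_cmult ennreal_mult_less_top)
  have lim': "(\<lambda>k. indicator S y * I k y) \<longlonglongrightarrow> indicator S y * \<beta> y" for y
    using lim[of y] by (cases "y \<in> S") auto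
  have "(\<lambda>k. \<integral>\<^sup>+y. indicator S y * I k y \<partial>lborel) \<longlonglongrightarrow> (\<integral>\<^sup>+y. indicator S y * \<beta> y \<partial>lborel)"
    using W_fin by (intro nn_integral_dominated_convergence[where w=W] AE_I2 bound lim') auto
  then show ?lim
    unfolding flux meas[unfolded D_def] by simp
  have "(\<integral>\<^sup>+y. indicator S y * \<beta> y \<partial>lborel) \<le> (\<integral>\<^sup>+y. W y \<partial>lborel)"
    by (intro nn_integral_mono LIMSEQ_le_const2[OF lim']) (use bound in auto)
  then show "boundary_flux g K \<theta> < top"
    unfolding flux using W_fin by (rule le_less_trans)
qed

subsection \<open>Boxes and means\<close>

lemma scaleR_image_set_plus:
  fixes A B :: "'a::real_vector set"
  shows "(\<lambda>x. c *\<^sub>R x) ` (A + B) = (\<lambda>x. c *\<^sub>R x) ` A + (\<lambda>x. c *\<^sub>R x) ` B"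
proof (intro equalityI subsetI)
  fix z assume "z \<in> (\<lambda>x. c *\<^sub>R x) ` (A + B)"
  then obtain a b where "a \<in> A" "b \<in> B" "z = c *\<^sub>R a + c *\<^sub>R b"
    by (auto simp: set_plus_def scaleR_right_distrib)
  then show "z \<in> (\<lambda>x. c *\<^sub>R x) ` A + (\<lambda>x. c *\<^sub>R x) ` B"
    by auto
next
  fix z assume "z \<in> (\<lambda>x. c *\<^sub>R x) ` A + (\<lambda>x. c *\<^sub>R x) ` B"
  then obtain a b where "a \<in> A" "b \<in> B" "z = c *\<^sub>R (a + b)"
    by (auto simp: set_plus_def scaleR_right_distrib)
  then show "z \<in> (\<lambda>x. c *\<^sub>R x) ` (A + B)"
    by auto
qed

definition box_sum :: "('n \<Rightarrow> real^'n) \<Rightarrow> ('n \<Rightarrow> real) \<Rightarrow> 'n set \<Rightarrow> (real^'n) set" where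
  "box_sum u l F = (\<Sum>i\<in>F. (\<lambda>x. l i *\<^sub>R x) ` sym_segment (u i))"

lemma box_sum_empty: "box_sum u l {} = {0}"
  by (simp add: box_sum_def set_zero)

lemma box_sum_insert:
  "i \<notin> F \<Longrightarrow> box_sum u l (insert i F) = box_sum u l F + (\<lambda>x. l i *\<^sub>R x) ` sym_segment (u i)"
  by (simp add: box_sum_def add.commute)

lemma compact_box_sum: "compact (box_sum u l F)"
proof (induction F rule: infinite_finite_induct)
  case (insert i F)
  then show ?case
    by (simp add: box_sum_insert compact_set_plus compact_scaling compact_sym_segment)
qed (auto simp: box_sum_empty)

lemma convex_box_sum: "convex (box_sum u l F)"
proof (induction F rule: infinite_finite_induct)
  case (insert i F)
  then show ?case
    by (simp add: box_sum_insert convex_set_plus convex_scaling convex_sym_segment)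
qed (auto simp: box_sum_empty)

lemma zero_in_box_sum: "0 \<in> box_sum u l F"
proof (induction F rule: infinite_finite_induct)
  case (insert i F)
  have "0 \<in> sym_segment (u i)"
    by (auto simp: sym_segment_def intro!: exI[of _ 0])
  then have "0 + l i *\<^sub>R 0 \<in> box_sum u l (insert i F)"
    unfolding box_sum_insert[OF insert.hyps(2)] by (intro set_plus_intro imageI insert.IH)
  then show ?case
    by simp
qed (auto simp: box_sum_empty)

lemma scaleR_box_sum:
  "(\<lambda>x. c *\<^sub>R x) ` box_sum u l F = box_sum u (\<lambda>i. c * l i) F"
proof (induction F rule: infinite_finite_induct)
  case (insert i F)
  then show ?case
    by (simp add: box_sum_insert scaleR_image_set_plus image_image)
qed (auto simp: box_sum_empty)

lemma sum_scaleR_mem_box_sum: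
  shows "finite F \<Longrightarrow> (\<And>i. i \<in> F \<Longrightarrow> \<bar>t i\<bar> \<le> l i \<and> l i > 0) \<Longrightarrow>
    (\<Sum>i\<in>F. t i *\<^sub>R u i) \<in> box_sum u l F"
proof (induction F rule: finite_induct)
  case (insert i F)
  have "t i *\<^sub>R u i \<in> {0} + (\<lambda>x. l i *\<^sub>R x) ` sym_segment (u i)"
    using insert.prems[of i] mem_plus_sym_segment[of "l i" "t i *\<^sub>R u i" "{0}" "u i"] by auto
  then have "t i *\<^sub>R u i \<in> (\<lambda>x. l i *\<^sub>R x) ` sym_segment (u i)"
    by (simp add: set_plus_def)
  then show ?case
    using insert by (simp add: box_sum_insert add.commute[of "t i *\<^sub>R u i"] set_plus_intro)
qed (simp add: box_sum_empty)

text \<open>Sum \<open>ln x \<le> x - 1\<close> over \<open>x = t i / A\<close> with the weights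
  \<open>w i\<close>: the right side vanishes, because the weighted mean of the
  \<open>t i / A\<close> is \<open>1\<close>.\<close>

lemma weighted_arith_geom_mean:
  fixes w t :: "'a \<Rightarrow> real"
  assumes F: "finite F" and w: "\<And>i. i \<in> F \<Longrightarrow> w i \<ge> 0" "sum w F = 1"
    and t: "\<And>i. i \<in> F \<Longrightarrow> t i > 0"
  shows "(\<Prod>i\<in>F. t i powr w i) \<le> (\<Sum>i\<in>F. w i * t i)"
proof -
  define A where "A = (\<Sum>i\<in>F. w i * t i)"
  have "A > 0"
  proof -
    obtain i where i: "i \<in> F" "w i > 0"
      using w by (metis not_less_iff_gr_or_eq order_le_less sum.neutral zero_neq_one)
    then show ?thesis
      unfolding A_def using F w t by (intro sum_pos2[of F i]) (auto intro!: mult_nonneg_nonneg intro: less_imp_le)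
  qed
  have "(\<Sum>i\<in>F. w i * ln (t i)) - ln A = (\<Sum>i\<in>F. w i * (ln (t i) - ln A))"
    using w(2) by (simp add: right_diff_distrib sum_subtractf sum_distrib_right[symmetric])
  also have "\<dots> = (\<Sum>i\<in>F. w i * ln (t i / A))"
  proof (intro sum.cong refl)
    fix i assume "i \<in> F"
    then have "t i > 0"
      by (rule t)
    then show "w i * (ln (t i) - ln A) = w i * ln (t i / A)"
      using \<open>A > 0\<close> by (simp add: ln_div)
  qed
  also have "\<dots> \<le> (\<Sum>i\<in>F. w i * (t i / A - 1))"
    using t w(1) \<open>A > 0\<close> by (intro sum_mono mult_left_mono ln_le_minus_one) auto
  also have "\<dots> = (\<Sum>i\<in>F. w i * t i) / A - 1"
    by (simp add: right_diff_distrib sum_subtractf w(2) sum_divide_distrib)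
  also have "\<dots> = A / A - 1"
    by (simp add: A_def)
  finally have "(\<Sum>i\<in>F. w i * ln (t i)) \<le> ln A"
    using \<open>A > 0\<close> by simp
  then have "exp (\<Sum>i\<in>F. w i * ln (t i)) \<le> A"
    using \<open>A > 0\<close> by (metis exp_le_cancel_iff exp_ln)
  moreover have "(\<Prod>i\<in>F. t i powr w i) = exp (\<Sum>i\<in>F. w i * ln (t i))"
    unfolding exp_sum[OF F]
  proof (intro prod.cong refl)
    fix i assume "i \<in> F"
    then have "t i > 0"
      by (rule t)
    then show "t i powr w i = exp (w i * ln (t i))"
      by (simp add: powr_def)
  qed
  ultimately show ?thesis
    by (simp add: A_def)
qed

lemma prod_le_mean_power:
  fixes t :: "'n::finite \<Rightarrow> real"
  assumes t: "\<And>i. t i > 0"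
  shows "(\<Prod>i\<in>UNIV. t i) \<le> ((\<Sum>i\<in>UNIV. t i) / CARD('n)) ^ CARD('n)"
proof -
  have "(\<Prod>i\<in>UNIV. t i powr (1 / CARD('n))) \<le> (\<Sum>i\<in>UNIV. 1 / CARD('n) * t i)"
    using t by (intro weighted_arith_geom_mean) auto
  then have "(\<Prod>i\<in>UNIV. t i powr (1 / CARD('n))) ^ CARD('n) \<le> ((\<Sum>i\<in>UNIV. t i) / CARD('n)) ^ CARD('n)"
    by (intro power_mono prod_nonneg) (auto simp: sum_divide_distrib)
  moreover have "(t i powr (1 / CARD('n))) ^ CARD('n) = t i" for i
    using t[of i] by (simp add: powr_realpow[symmetric] powr_powr)
  ultimately show ?thesis
    by (simp add: prod_power_distrib)
qed

lemma nn_integral_vec_prod: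
  fixes f :: "'n::finite \<Rightarrow> real \<Rightarrow> ennreal"
  assumes [measurable]: "\<And>i. f i \<in> borel_measurable borel"
  shows "(\<integral>\<^sup>+x. (\<Prod>i\<in>UNIV. f i (x $ i)) \<partial>(lborel :: (real^'n) measure))
    = (\<Prod>i\<in>UNIV. \<integral>\<^sup>+t. f i t \<partial>lborel)"
proof -
  have Basis: "(\<Prod>b\<in>(Basis :: (real^'n) set). k b) = (\<Prod>i\<in>UNIV. k (axis i 1))" for k :: "real^'n \<Rightarrow> ennreal"
    by (simp add: Basis_vec_def UNION_singleton_eq_range prod.reindex axis_eq_axis inj_on_def)
  have "(\<integral>\<^sup>+x. (\<Prod>b\<in>(Basis :: (real^'n) set). f (axis_index b) (x \<bullet> b)) \<partial>lborel)
      = (\<Prod>b\<in>(Basis :: (real^'n) set). \<integral>\<^sup>+t. f (axis_index b) t \<partial>lborel)"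
    by (intro nn_integral_lborel_prod) auto
  then show ?thesis
    by (simp add: Basis cart_eq_inner_axis[symmetric])
qed

lemma nn_integral_powr_Ioc:
  fixes l a :: real
  assumes "l > 0" "a > 0"
  shows "(\<integral>\<^sup>+t. ennreal (t powr a) * indicator {0<..l} t \<partial>lborel) = ennreal (l powr (1 + a) / (1 + a))"
proof -
  have "(\<integral>\<^sup>+t. ennreal (t powr a) * indicator {0<..l} t \<partial>lborel)
      = (\<integral>\<^sup>+t. ennreal (t powr a) * indicator {0..l} t \<partial>lborel)"
    by (intro nn_integral_cong) (auto split: split_indicator)
  also have "\<dots> = ennreal (l powr (a + 1) / (a + 1))"
    using assms by (intro nn_integral_has_integral_lebesgue' has_integral_powr_from_0) auto
  finally show ?thesis
    by (simp add: add.commute)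
qed

lemma orthonormal_basis_expansion:
  assumes "orthonormal_basis v"
  shows "(\<Sum>i\<in>UNIV. (x \<bullet> v i) *\<^sub>R v i) = x"
proof -
  have v: "v i \<bullet> v j = (if i = j then 1 else 0)" for i j
    using assms by (simp add: orthonormal_basis_def)
  let ?d = "x - (\<Sum>i\<in>UNIV. (x \<bullet> v i) *\<^sub>R v i)"
  have "?d \<bullet> v j = 0" for j
    by (simp add: inner_diff_left inner_sum_left v if_distrib cong: if_cong)
  then have "orthogonal ?d y" if "y \<in> span (range v)" for y
    using that by (intro orthogonal_to_span[of y "range v"]) (auto simp: orthogonal_def)
  then have "orthogonal ?d ?d"
    using assms by (simp add: orthonormal_basis_def)
  then show ?thesis
    by (simp add: orthogonal_self)
qed

subsection \<open>Minkowski's first inequality\<close>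

locale homogeneous_concave_density =
  fixes p :: real and g :: "real^'n \<Rightarrow> real"
  assumes p_pos: "p > 0" and g_nonneg: "\<And>x. g x \<ge> 0" and g_cont: "continuous_on UNIV g"
    and g_concave: "p_concave p g" and g_homogeneous: "homogeneous_of_degree (1 / p) g"
begin

section \<open>Homogeneity and log-concavity of the measure\<close>

definition mu :: "(real^'n) measure" where
  "mu = density lborel (\<lambda>x. ennreal (g x))"

definition N :: real where
  "N = real CARD('n) + 1 / p"

lemma N_gt_1: "N > 1"
proof -
  have "CARD('n) > 0"
    by simp
  then have "real CARD('n) \<ge> 1"
    by linarith
  moreover have "1 / p > 0"
    using p_pos by simp
  ultimately show ?thesis
    unfolding N_def by linarith
qed

lemma g_measurable [measurable]: "g \<in> borel_measurable borel"
  using g_cont by (rule borel_measurable_continuous_onI)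

lemma sets_mu [simp, measurable_cong]: "sets mu = sets borel"
  by (simp add: mu_def)

lemma emeasure_mu: "A \<in> sets borel \<Longrightarrow> emeasure mu A = (\<integral>\<^sup>+x. ennreal (g x) * indicator A x \<partial>lborel)"
  by (simp add: mu_def emeasure_density)

lemma emeasure_mu_compact:
  assumes "compact A"
  shows "emeasure mu A = ennreal (measure mu A)"
proof -
  have "compact (g ` A)"
    by (intro compact_continuous_image continuous_on_subset[OF g_cont] assms) auto
  from compact_imp_bounded[OF this] obtain G where "\<forall>z\<in>g ` A. norm z \<le> G"
    unfolding bounded_iff ..
  then have G: "g x \<le> G" if "x \<in> A" for x
    using that by (simp add: abs_le_iff)
  have "emeasure mu A \<le> (\<integral>\<^sup>+x. ennreal G * indicator A x \<partial>lborel)"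
    unfolding emeasure_mu[OF borel_compact[OF assms]]
    by (intro nn_integral_mono) (auto split: split_indicator intro!: ennreal_leI G)
  also have "\<dots> = ennreal G * emeasure lborel A"
    using borel_compact[OF assms] by (simp add: nn_integral_cmult)
  also have "\<dots> < top"
    using emeasure_compact_finite[OF assms] by (simp add: ennreal_mult_less_top)
  finally show ?thesis
    by (intro emeasure_eq_ennreal_measure) auto
qed

lemma measure_mu_mono:
  assumes "A \<subseteq> B" "compact A" "compact B"
  shows "measure mu A \<le> measure mu B"
  using emeasure_mono[OF assms(1), of mu] assms
  by (simp add: emeasure_mu_compact borel_compact)

lemma measure_mu_scale:
  assumes c: "c > 0" and A: "compact A"
  shows "measure mu ((\<lambda>x. c *\<^sub>R x) ` A) = c powr N * measure mu A"
proof -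
  note [measurable] = borel_compact[OF A] borel_compact[OF compact_scaling[OF A, of c]]
  have mem: "c *\<^sub>R x \<in> (\<lambda>x. c *\<^sub>R x) ` A \<longleftrightarrow> x \<in> A" for x
    using c by auto
  have "emeasure mu ((\<lambda>x. c *\<^sub>R x) ` A)
      = ennreal (c ^ CARD('n)) * (\<integral>\<^sup>+x. ennreal (g (c *\<^sub>R x)) * indicator ((\<lambda>x. c *\<^sub>R x) ` A) (c *\<^sub>R x) \<partial>lborel)"
    using c nn_integral_lborel_affine[of "\<lambda>x. ennreal (g x) * indicator ((\<lambda>x. c *\<^sub>R x) ` A) x" c 0]
    by (simp add: emeasure_mu)
  also have "(\<integral>\<^sup>+x. ennreal (g (c *\<^sub>R x)) * indicator ((\<lambda>x. c *\<^sub>R x) ` A) (c *\<^sub>R x) \<partial>lborel)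
      = (\<integral>\<^sup>+x. ennreal (c powr (1 / p)) * (ennreal (g x) * indicator A x) \<partial>lborel)"
    using c g_homogeneous unfolding homogeneous_of_degree_def
    by (intro nn_integral_cong) (simp add: indicator_def mem ennreal_mult g_nonneg mult_ac)
  also have "\<dots> = ennreal (c powr (1 / p)) * emeasure mu A"
    by (simp add: nn_integral_cmult emeasure_mu)
  finally have "ennreal (measure mu ((\<lambda>x. c *\<^sub>R x) ` A))
      = ennreal (c ^ CARD('n) * (c powr (1 / p) * measure mu A))"
    using c by (simp add: emeasure_mu_compact A compact_scaling ennreal_mult)
  then have "measure mu ((\<lambda>x. c *\<^sub>R x) ` A) = c ^ CARD('n) * (c powr (1 / p) * measure mu A)"
    using c by (subst (asm) ennreal_inj) auto
  then show ?thesis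
    using c by (simp add: N_def powr_add powr_realpow)
qed

lemma g_powr_midpoint:
  assumes "g x > 0" "g y > 0"
  shows "((g x powr p + g y powr p) / 2) powr (1 / p) \<le> g ((1/2) *\<^sub>R (x + y))"
proof -
  have "(1/2) \<in> {0..1::real}" "x \<in> pos_supp g" "y \<in> pos_supp g"
    using assms by (auto simp: pos_supp_def)
  then have "((1/2) * g x powr p + (1 - 1/2) * g y powr p) powr (1 / p)
      \<le> g ((1/2) *\<^sub>R x + (1 - 1/2) *\<^sub>R y)"
    using g_concave unfolding p_concave_def by blast
  then show ?thesis
    by (simp add: add_divide_distrib scaleR_right_distrib)
qed

text \<open>The power mean of \<open>g x\<close> and \<open>g y\<close> with exponent
  \<open>p\<close> dominates their geometric mean. Off the support the left side is
  \<open>0\<close>, so the restriction of p-concavity to the support does no harm.\<close>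

lemma g_midpoint: "g x * g y \<le> (g ((1/2) *\<^sub>R (x + y)))\<^sup>2"
proof (cases "g x > 0 \<and> g y > 0")
  case True
  define a b where "a = g x powr p" and "b = g y powr p"
  have ab: "a > 0" "b > 0" "g x = a powr (1/p)" "g y = b powr (1/p)"
    using True p_pos by (auto simp: a_def b_def powr_powr)
  have *: "((a + b) / 2) powr (1/p) \<le> g ((1/2) *\<^sub>R (x + y))"
    unfolding a_def b_def using True by (intro g_powr_midpoint) auto
  have "a * b \<le> ((a + b) / 2)\<^sup>2"
    using zero_le_power2[of "a - b"] by (simp add: power2_eq_square field_simps)
  then have "g x * g y \<le> (((a + b) / 2)\<^sup>2) powr (1/p)"
    using ab p_pos by (simp add: powr_mult[symmetric] powr_mono2)
  also have "\<dots> = (((a + b) / 2) powr (1/p))\<^sup>2"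
    using ab powr_mult[of "(a + b) / 2" "(a + b) / 2" "1 / p"] by (simp add: power2_eq_square)
  also have "\<dots> \<le> (g ((1/2) *\<^sub>R (x + y)))\<^sup>2"
    using * by (intro power_mono) auto
  finally show ?thesis .
next
  case False
  then have "g x = 0 \<or> g y = 0"
    using g_nonneg[of x] g_nonneg[of y] by linarith
  then show ?thesis
    by auto
qed

lemma measure_mu_midpoint:
  assumes A: "compact A" and B: "compact B"
  shows "measure mu A * measure mu B \<le> (measure mu ((\<lambda>x. (1/2) *\<^sub>R x) ` (A + B)))\<^sup>2"
proof -
  let ?M = "(\<lambda>x. (1/2) *\<^sub>R x) ` (A + B)"
  have M: "compact ?M"
    by (intro compact_scaling compact_set_plus A B)
  note [measurable] = borel_compact[OF A] borel_compact[OF B] borel_compact[OF M]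
  have "emeasure mu A * emeasure mu B \<le> (emeasure mu ?M)\<^sup>2"
    unfolding emeasure_mu[OF borel_compact[OF A]] emeasure_mu[OF borel_compact[OF B]]
      emeasure_mu[OF borel_compact[OF M]]
  proof (rule prekopa_leindler_midpoint)
    fix x y
    have "ennreal (g x) * ennreal (g y) \<le> (ennreal (g ((1/2) *\<^sub>R (x + y))))\<^sup>2"
      using g_midpoint[of x y] g_nonneg by (simp add: ennreal_mult[symmetric] ennreal_power)
    then show "ennreal (g x) * indicator A x * (ennreal (g y) * indicator B y)
        \<le> (ennreal (g ((1/2) *\<^sub>R (x + y))) * indicator ?M ((1/2) *\<^sub>R (x + y)))\<^sup>2"
      by (auto split: split_indicator)
  qed measurable
  then show ?thesis
    unfolding emeasure_mu_compact[OF A] emeasure_mu_compact[OF B] emeasure_mu_compact[OF M]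
    by (simp add: ennreal_mult[symmetric] ennreal_power)
qed

text \<open>Midpoint concavity suffices: iterating \<open>A \<mapsto> (K + A) / 2\<close> from \<open>Z\<close> yields the convex combinations
  with weights \<open>2\<close> to the power \<open>- k\<close>, and these already determine the derivative at \<open>K\<close>.\<close>
lemma measure_mu_interpolate:
  assumes K: "compact K" "convex K" and Z: "compact Z" and eq: "measure mu Z = measure mu K"
  defines "e \<equiv> \<lambda>k::nat. (1/2) ^ Suc k"
  shows "measure mu K \<le> measure mu ((\<lambda>x. (1 - e k) *\<^sub>R x) ` K + (\<lambda>x. e k *\<^sub>R x) ` Z)"
proof (induction k)
  case 0
  have "(measure mu K)\<^sup>2 \<le> (measure mu ((\<lambda>x. (1/2) *\<^sub>R x) ` (K + Z)))\<^sup>2"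
    using measure_mu_midpoint[OF K(1) Z] by (simp add: eq power2_eq_square)
  then have "measure mu K \<le> measure mu ((\<lambda>x. (1/2) *\<^sub>R x) ` (K + Z))"
    by (rule power2_le_imp_le) simp
  then show ?case
    by (simp add: e_def scaleR_image_set_plus)
next
  case (Suc k)
  let ?A = "\<lambda>k. (\<lambda>x. (1 - e k) *\<^sub>R x) ` K + (\<lambda>x. e k *\<^sub>R x) ` Z"
  have A: "compact (?A k)" for k
    by (intro compact_set_plus compact_scaling K Z)
  have e: "0 < e k" "e k \<le> 1 / 2" for k
    using power_le_one[of "1/2::real" k] by (auto simp: e_def)
  \<comment> \<open>Convexity merges the two copies of \<open>K\<close>, of weights
    \<open>1/2\<close> and \<open>(1 - e k) / 2\<close>, into one of weight
    \<open>c = 1 - e (Suc k)\<close>, while the weight of \<open>Z\<close> is halved.\<close>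
  have "(\<lambda>x. (1/2) *\<^sub>R x) ` (K + ?A k) \<subseteq> ?A (Suc k)"
  proof
    fix w assume "w \<in> (\<lambda>x. (1/2) *\<^sub>R x) ` (K + ?A k)"
    then obtain x y z where xyz: "x \<in> K" "y \<in> K" "z \<in> Z"
      and w: "w = (1/2) *\<^sub>R (x + ((1 - e k) *\<^sub>R y + e k *\<^sub>R z))"
      by (auto simp: set_plus_def)
    define c where "c = 1 - e (Suc k)"
    have c: "c > 0" "c = (1/2) + (1/2) * (1 - e k)"
      using e[of "Suc k"] by (auto simp: c_def e_def diff_divide_distrib)
    have "((1/2) / c) *\<^sub>R x + ((1/2) * (1 - e k) / c) *\<^sub>R y \<in> K"
      using c e[of k] by (intro convexD[OF K(2) xyz(1,2)]) (auto simp: add_divide_distrib[symmetric])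
    moreover have "w = c *\<^sub>R (((1/2) / c) *\<^sub>R x + ((1/2) * (1 - e k) / c) *\<^sub>R y) + e (Suc k) *\<^sub>R z"
      using c(1) by (simp add: w e_def scaleR_right_distrib)
    ultimately show "w \<in> ?A (Suc k)"
      using xyz(3) unfolding c_def by (metis imageI set_plus_intro)
  qed
  then have "measure mu ((\<lambda>x. (1/2) *\<^sub>R x) ` (K + ?A k)) \<le> measure mu (?A (Suc k))"
    by (intro measure_mu_mono compact_scaling compact_set_plus K A)
  moreover have "measure mu K \<le> measure mu ((\<lambda>x. (1/2) *\<^sub>R x) ` (K + ?A k))"
  proof (rule power2_le_imp_le)
    have "(measure mu K)\<^sup>2 \<le> measure mu K * measure mu (?A k)"
      unfolding power2_eq_square by (intro mult_left_mono Suc.IH) auto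
    also have "\<dots> \<le> (measure mu ((\<lambda>x. (1/2) *\<^sub>R x) ` (K + ?A k)))\<^sup>2"
      by (rule measure_mu_midpoint[OF K(1) A])
    finally show "(measure mu K)\<^sup>2 \<le> (measure mu ((\<lambda>x. (1/2) *\<^sub>R x) ` (K + ?A k)))\<^sup>2" .
  qed simp
  ultimately show ?case
    by (rule order_trans[rotated])
qed

text \<open>Factoring \<open>1 - e\<close> out of \<open>(1 - e) K + e Z\<close> leaves
  \<open>K + \<epsilon> Z\<close> with \<open>\<epsilon> = e / (1 - e)\<close>. By homogeneity the
  interpolation inequality becomes
  \<open>mu(K + \<epsilon> Z) \<ge> (1 - e) powr (- N) * mu(K)\<close>, and its linear term in
  \<open>e\<close> gives the factor \<open>N\<close>. As \<open>e / \<epsilon> = 1 - e\<close>, the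
  change of parameter disappears in the limit.\<close>

lemma minkowski_normalized:
  assumes K: "compact K" "convex K" and Z: "compact Z" and eq: "measure mu Z = measure mu K"
    and lim: "\<And>\<epsilon>. (\<And>k. \<epsilon> k > 0) \<Longrightarrow> \<epsilon> \<longlonglongrightarrow> 0 \<Longrightarrow>
      (\<lambda>k. (measure mu (K + (\<lambda>x. \<epsilon> k *\<^sub>R x) ` Z) - measure mu K) / \<epsilon> k) \<longlonglongrightarrow> V"
  shows "N * measure mu K \<le> V"
proof -
  define e where "e = (\<lambda>k::nat. (1/2::real) ^ Suc k)"
  define \<epsilon> where "\<epsilon> = (\<lambda>k. e k / (1 - e k))"
  have e: "0 < e k" "e k \<le> 1 / 2" for k
    using power_le_one[of "1/2::real" k] by (auto simp: e_def)
  have e0: "e \<longlonglongrightarrow> 0"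
    unfolding e_def by (intro LIMSEQ_Suc LIMSEQ_power_zero) auto
  have \<epsilon>: "\<epsilon> k > 0" for k
    using e[of k] by (simp add: \<epsilon>_def)
  have "\<epsilon> \<longlonglongrightarrow> 0 / (1 - 0)"
    unfolding \<epsilon>_def by (intro tendsto_intros e0) auto
  then have V: "(\<lambda>k. (measure mu (K + (\<lambda>x. \<epsilon> k *\<^sub>R x) ` Z) - measure mu K) / \<epsilon> k) \<longlonglongrightarrow> V"
    using lim[of \<epsilon>] \<epsilon> by simp
  have le: "measure mu K * N * (1 - e k) \<le> (measure mu (K + (\<lambda>x. \<epsilon> k *\<^sub>R x) ` Z) - measure mu K) / \<epsilon> k" for k
  proof -
    define c where "c = 1 - e k"
    have c: "c > 0" "c = 1 - e k" "\<epsilon> k = e k / c"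
      using e[of k] by (auto simp: c_def \<epsilon>_def)
    let ?Q = "K + (\<lambda>x. \<epsilon> k *\<^sub>R x) ` Z"
    have Q: "compact ?Q"
      by (intro compact_set_plus compact_scaling K Z)
    have "(\<lambda>x. c *\<^sub>R x) ` ?Q = (\<lambda>x. c *\<^sub>R x) ` K + (\<lambda>x. e k *\<^sub>R x) ` Z"
      unfolding scaleR_image_set_plus image_image using c by simp
    then have "measure mu K \<le> measure mu ((\<lambda>x. c *\<^sub>R x) ` ?Q)"
      using measure_mu_interpolate[OF K Z eq, of k] by (simp add: c_def e_def)
    also have "\<dots> = c powr N * measure mu ?Q"
      using c by (intro measure_mu_scale Q) auto
    finally have *: "measure mu K * c powr (- N) \<le> measure mu ?Q"
      using c(1) by (simp add: powr_minus divide_inverse[symmetric] pos_divide_le_eq mult.commute)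
    \<comment> \<open>A Bernoulli inequality for \<open>c powr (- N)\<close>, from
      \<open>ln c \<le> c - 1\<close> and \<open>1 + x \<le> exp x\<close>.\<close>
    have "1 + N * e k \<le> exp (- N * ln c)"
    proof -
      have "ln c \<le> - e k"
        using ln_le_minus_one[of c] c by simp
      then have "N * e k \<le> - N * ln c"
        using N_gt_1 mult_left_mono[of "ln c" "- e k" N] by simp
      then show ?thesis
        using exp_ge_add_one_self[of "- N * ln c"] by linarith
    qed
    then have "measure mu K * (1 + N * e k) \<le> measure mu K * c powr (- N)"
      using c by (intro mult_left_mono) (auto simp: powr_def)
    with * have "measure mu K * N * e k \<le> measure mu ?Q - measure mu K"
      by (simp add: algebra_simps)
    then have "measure mu K * N * e k / \<epsilon> k \<le> (measure mu ?Q - measure mu K) / \<epsilon> k"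
      using \<epsilon>[of k] by (intro divide_right_mono) auto
    moreover have "measure mu K * N * e k / \<epsilon> k = measure mu K * N * (1 - e k)"
      using c e[of k] by simp
    ultimately show ?thesis
      by simp
  qed
  have "(\<lambda>k. measure mu K * N * (1 - e k)) \<longlonglongrightarrow> measure mu K * N * (1 - 0)"
    by (intro tendsto_intros e0)
  then have "measure mu K * N * (1 - 0) \<le> V"
    using V le by (intro LIMSEQ_le[of "\<lambda>k. measure mu K * N * (1 - e k)"]) auto
  then show ?thesis
    by (simp add: mult.commute)
qed

section \<open>First variation of the measure along a box\<close>

definition flux :: "(real^'n) set \<Rightarrow> real^'n \<Rightarrow> real" where
  "flux K \<theta> = enn2real (boundary_flux g K \<theta>)"

lemma flux_nonneg: "flux K \<theta> \<ge> 0"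
  by (simp add: flux_def)

lemma first_variation_mu:
  assumes K: "compact K" "convex K" and \<theta>: "norm \<theta> = 1"
    and KL: "\<And>k. K \<subseteq> L k" and cL: "\<And>k. compact (L k)" "\<And>k. convex (L k)"
    and L: "\<And>k z. z \<in> L k \<Longrightarrow> \<exists>x\<in>K. dist x z \<le> \<eta> k" and \<eta>: "\<eta> \<longlonglongrightarrow> 0"
    and \<delta>: "\<And>k. \<delta> k > 0" "\<delta> \<longlonglongrightarrow> 0"
  shows "(\<lambda>k. (measure mu (L k + (\<lambda>b. \<delta> k *\<^sub>R b) ` sym_segment \<theta>) - measure mu (L k)) / \<delta> k)
    \<longlonglongrightarrow> flux K \<theta>"
proof -
  note fv = first_variation_sym_segment[OF g_cont g_nonneg K \<theta> KL cL L \<eta> \<delta>, folded mu_def]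
  let ?Q = "\<lambda>k. L k + (\<lambda>b. \<delta> k *\<^sub>R b) ` sym_segment \<theta>"
  have Q: "compact (?Q k)" for k
    by (intro compact_set_plus compact_scaling compact_sym_segment cL)
  have "(measure mu (?Q k) - measure mu (L k)) / \<delta> k = enn2real (emeasure mu (?Q k - L k) / ennreal (\<delta> k))" for k
  proof -
    have "emeasure mu (?Q k - L k) = emeasure mu (?Q k) - emeasure mu (L k)"
      using plus_sym_segment_superset[OF \<delta>(1)] Q cL
      by (intro emeasure_Diff) (auto simp: borel_compact emeasure_mu_compact)
    also have "\<dots> = ennreal (measure mu (?Q k) - measure mu (L k))"
      by (simp add: emeasure_mu_compact Q cL ennreal_minus)
    finally show ?thesis
      using \<delta>(1)[of k] measure_mu_mono[OF plus_sym_segment_superset[OF \<delta>(1)] cL(1) Q, of k]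
      by (simp add: divide_ennreal)
  qed
  moreover have "(\<lambda>k. enn2real (emeasure mu (?Q k - L k) / ennreal (\<delta> k))) \<longlonglongrightarrow> enn2real (boundary_flux g K \<theta>)"
    using fv by (intro tendsto_enn2real) auto
  ultimately show ?thesis
    by (simp add: flux_def)
qed

text \<open>The increments telescope. The segment for \<open>i\<close> is added not to
  \<open>K\<close> but to \<open>L k\<close>, which contains \<open>K\<close> and lies within
  \<open>\<epsilon> k * R\<close> of it, so the quotient still tends to the flux of
  \<open>K\<close>. The step for this segment has length \<open>\<epsilon> k * l i\<close>, whence
  the factor \<open>l i\<close>.\<close>

lemma first_variation_box_sum:
  assumes K: "compact K" "convex K" and u: "\<And>i. norm (u i) = 1" and l: "\<And>i. l i > 0"
    and \<epsilon>: "\<And>k. \<epsilon> k > 0" "\<epsilon> \<longlonglongrightarrow> 0"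
  shows "(\<lambda>k. (measure mu (K + (\<lambda>x. \<epsilon> k *\<^sub>R x) ` box_sum u l F) - measure mu K) / \<epsilon> k)
    \<longlonglongrightarrow> (\<Sum>i\<in>F. l i * flux K (u i))"
proof (induction F rule: infinite_finite_induct)
  case (insert i F)
  define L where "L = (\<lambda>k. K + (\<lambda>x. \<epsilon> k *\<^sub>R x) ` box_sum u l F)"
  define Q where "Q = (\<lambda>k. L k + (\<lambda>x. (\<epsilon> k * l i) *\<^sub>R x) ` sym_segment (u i))"
  have Q: "K + (\<lambda>x. \<epsilon> k *\<^sub>R x) ` box_sum u l (insert i F) = Q k" for k
    unfolding Q_def L_def box_sum_insert[OF insert.hyps(2)] scaleR_image_set_plus image_image
    by (simp add: add.assoc)
  obtain R where R: "\<And>z. z \<in> box_sum u l F \<Longrightarrow> norm z \<le> R"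
    using compact_imp_bounded[OF compact_box_sum[of u l F]] by (auto simp: bounded_iff)
  have "(\<lambda>k. (measure mu (Q k) - measure mu (L k)) / (\<epsilon> k * l i)) \<longlonglongrightarrow> flux K (u i)"
    unfolding Q_def
  proof (rule first_variation_mu[OF K u, where \<eta> = "\<lambda>k. \<epsilon> k * R"])
    show "K \<subseteq> L k" for k
    proof
      fix x assume "x \<in> K"
      then have "x + \<epsilon> k *\<^sub>R 0 \<in> L k"
        unfolding L_def by (intro set_plus_intro imageI zero_in_box_sum)
      then show "x \<in> L k"
        by simp
    qed
    show "compact (L k)" "convex (L k)" for k
      unfolding L_def using K
      by (auto intro!: compact_set_plus compact_scaling compact_box_sum convex_set_plus convex_scaling convex_box_sum)
    show "\<exists>x\<in>K. dist x z \<le> \<epsilon> k * R" if z: "z \<in> L k" for k z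
    proof -
      obtain x y where xy: "x \<in> K" "y \<in> box_sum u l F" "z = x + \<epsilon> k *\<^sub>R y"
        using z by (auto simp: L_def set_plus_def)
      then have "dist x z \<le> \<epsilon> k * R"
        using \<epsilon>(1)[of k] R[OF xy(2)] by (simp add: dist_norm)
      with xy(1) show ?thesis ..
    qed
    show "(\<lambda>k. \<epsilon> k * R) \<longlonglongrightarrow> 0" "(\<lambda>k. \<epsilon> k * l i) \<longlonglongrightarrow> 0"
      using tendsto_mult_right[OF \<epsilon>(2)] tendsto_mult_left_zero[OF \<epsilon>(2)] by auto
    show "\<epsilon> k * l i > 0" for k
      using \<epsilon>(1)[of k] l[of i] by simp
  qed
  then have "(\<lambda>k. l i * ((measure mu (Q k) - measure mu (L k)) / (\<epsilon> k * l i))) \<longlonglongrightarrow> l i * flux K (u i)"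
    by (rule tendsto_mult_left)
  moreover have "l i * ((measure mu (Q k) - measure mu (L k)) / (\<epsilon> k * l i))
      = (measure mu (Q k) - measure mu (L k)) / \<epsilon> k" for k
    using l[of i] by simp
  ultimately have "(\<lambda>k. (measure mu (Q k) - measure mu (L k)) / \<epsilon> k
      + (measure mu (L k) - measure mu K) / \<epsilon> k)
      \<longlonglongrightarrow> l i * flux K (u i) + (\<Sum>i\<in>F. l i * flux K (u i))"
    using insert.IH unfolding L_def by (intro tendsto_add) simp_all
  moreover have "(measure mu (Q k) - measure mu (L k)) / \<epsilon> k + (measure mu (L k) - measure mu K) / \<epsilon> k
      = (measure mu (Q k) - measure mu K) / \<epsilon> k" for k
    by (simp add: add_divide_distrib[symmetric])
  ultimately show ?case
    using insert.hyps by (simp add: Q)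
qed (auto simp: box_sum_empty)

lemma minkowski_box_sum:
  assumes K: "compact K" "convex K" and u: "\<And>i. norm (u i) = 1" and l: "\<And>i. l i > 0"
    and m: "measure mu K > 0" and z: "measure mu (box_sum u l UNIV) > 0"
  shows "N * measure mu K * (measure mu (box_sum u l UNIV) / measure mu K) powr (1 / N)
    \<le> (\<Sum>i\<in>UNIV. l i * flux K (u i))"
proof -
  define M where "M = measure mu K"
  define z where "z = measure mu (box_sum u l UNIV)"
  \<comment> \<open>Chosen so that the box scaled by \<open>s\<close> has the measure of
    \<open>K\<close>. The variation is linear in the sides, so \<open>s\<close> factors out there
    and \<open>1 / s\<close> produces the power \<open>1 / N\<close>.\<close>
  define s where "s = (M / z) powr (1 / N)"
  have s: "s > 0" "s powr N = M / z"
    using assms N_gt_1 by (auto simp: s_def M_def z_def powr_powr)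
  have "measure mu (box_sum u (\<lambda>i. s * l i) UNIV) = measure mu K"
    unfolding scaleR_box_sum[symmetric] using s z
    by (simp add: measure_mu_scale compact_box_sum z_def[symmetric] M_def[symmetric])
  then have "N * measure mu K \<le> (\<Sum>i\<in>UNIV. s * l i * flux K (u i))"
  proof (rule minkowski_normalized[OF K compact_box_sum])
    fix \<epsilon> :: "nat \<Rightarrow> real"
    assume \<epsilon>: "\<And>k. \<epsilon> k > 0" "\<epsilon> \<longlonglongrightarrow> 0"
    show "(\<lambda>k. (measure mu (K + (\<lambda>x. \<epsilon> k *\<^sub>R x) ` box_sum u (\<lambda>i. s * l i) UNIV) - measure mu K) / \<epsilon> k)
        \<longlonglongrightarrow> (\<Sum>i\<in>UNIV. s * l i * flux K (u i))"
      by (rule first_variation_box_sum[OF K u _ \<epsilon>]) (simp add: s l)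
  qed
  then have "N * M \<le> s * (\<Sum>i\<in>UNIV. l i * flux K (u i))"
    by (simp add: M_def sum_distrib_left mult_ac)
  then have "N * M * (1 / s) \<le> (\<Sum>i\<in>UNIV. l i * flux K (u i))"
    using s by (simp add: field_simps)
  moreover have "1 / s = (z / M) powr (1 / N)"
    using m z by (simp add: s_def M_def z_def powr_divide)
  ultimately show ?thesis
    unfolding M_def z_def by metis
qed

subsection \<open>Measures of boxes\<close>

lemma g_scale: "c > 0 \<Longrightarrow> g (c *\<^sub>R x) = c powr (1 / p) * g x"
  using g_homogeneous by (simp add: homogeneous_of_degree_def)

lemma g_zero: "g 0 = 0"
proof -
  have "2 powr (1 / p) > (1::real)"
    using p_pos by simp
  moreover have "g 0 = 2 powr (1 / p) * g 0"
    using g_scale[of 2 0] by simp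
  ultimately show ?thesis
    by auto
qed

text \<open>Doubling the midpoint multiplies \<open>g\<close> by \<open>2 powr (1 / p)\<close>,
  which exactly cancels the \<open>1/2\<close> in the power mean.\<close>

lemma g_powr_superadditive:
  assumes "g x > 0" "g y > 0"
  shows "g x powr p + g y powr p \<le> g (x + y) powr p" "g (x + y) > 0"
proof -
  define s where "s = g x powr p + g y powr p"
  have "s > 0"
    using assms by (simp add: s_def add_pos_pos)
  have *: "(s / 2) powr (1/p) \<le> g ((1/2) *\<^sub>R (x + y))"
    unfolding s_def by (rule g_powr_midpoint[OF assms])
  have "s powr (1/p) = 2 powr (1/p) * (s / 2) powr (1/p)"
    using \<open>s > 0\<close> by (simp add: powr_divide)
  also have "\<dots> \<le> 2 powr (1/p) * g ((1/2) *\<^sub>R (x + y))"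
    using * by (intro mult_left_mono) auto
  also have "\<dots> = g (x + y)"
    using g_scale[of 2 "(1/2) *\<^sub>R (x + y)"] by simp
  finally have le: "s powr (1/p) \<le> g (x + y)" .
  moreover have "s powr (1/p) > 0"
    using \<open>s > 0\<close> by simp
  ultimately show "g (x + y) > 0"
    by linarith
  have "(s powr (1/p)) powr p \<le> g (x + y) powr p"
    using le p_pos by (intro powr_mono2) auto
  then show "g x powr p + g y powr p \<le> g (x + y) powr p"
    using \<open>s > 0\<close> p_pos by (simp add: powr_powr s_def)
qed

text \<open>If \<open>g\<close> were positive at both points, superadditivity would make it positive
  at their sum \<open>0\<close>, contrary to homogeneity.\<close>

lemma g_neg_zero:
  assumes "g x > 0"
  shows "g (- x) = 0"
  using g_powr_superadditive(2)[OF assms, of "- x"] g_nonneg[of "- x"] g_zero by fastforce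

text \<open>Positivity is carried through the induction because superadditivity is available only on
  the support. The factor \<open>t i\<close> enters linearly since \<open>g powr p\<close> is
  homogeneous of degree \<open>1\<close>.\<close>

lemma g_sum_lower:
  assumes "finite F" "F \<noteq> {}" and "\<And>i. i \<in> F \<Longrightarrow> g (v i) > 0 \<and> t i > 0"
  shows "g (\<Sum>i\<in>F. t i *\<^sub>R v i) > 0 \<and>
    (\<Sum>i\<in>F. t i * g (v i) powr p) \<le> g (\<Sum>i\<in>F. t i *\<^sub>R v i) powr p"
  using assms
proof (induction F rule: finite_ne_induct)
  have scale: "g (t i *\<^sub>R v i) > 0" "g (t i *\<^sub>R v i) powr p = t i * g (v i) powr p"
    if "g (v i) > 0" "t i > 0" for i
    using that p_pos by (simp_all add: g_scale powr_mult powr_powr)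
  {
    case (singleton i)
    then show ?case
      using scale[of i] by simp
  next
    case (insert i F)
    then have "g (\<Sum>i\<in>F. t i *\<^sub>R v i) > 0"
      "(\<Sum>i\<in>F. t i * g (v i) powr p) \<le> g (\<Sum>i\<in>F. t i *\<^sub>R v i) powr p"
      by auto
    then show ?case
      using insert.hyps insert.prems[of i] scale[of i]
        g_powr_superadditive[of "t i *\<^sub>R v i" "\<Sum>i\<in>F. t i *\<^sub>R v i"] by simp
  }
qed

text \<open>Only the part of the box in the open orthant spanned by the
  \<open>v i = \<sigma> i *\<^sub>R u i\<close> is counted. At coordinates \<open>c\<close> there,
  \<open>g powr p\<close> is at least the sum of the \<open>a i * c i\<close>, hence by weighted
  AM--GM at least \<open>S\<close> times the product of the \<open>c i powr (a i / S)\<close>. After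
  taking the power \<open>1 / p\<close> the integral splits into one-dimensional ones.\<close>

lemma measure_box_sum_lower:
  fixes v :: "'n \<Rightarrow> real^'n" and l \<sigma> :: "'n \<Rightarrow> real"
  assumes u: "orthonormal_basis u" and \<sigma>: "\<And>i. \<sigma> i = 1 \<or> \<sigma> i = - 1"
    and pos: "\<And>i. g (\<sigma> i *\<^sub>R u i) > 0" and l: "\<And>i. l i > 0"
  defines "a \<equiv> \<lambda>i. g (\<sigma> i *\<^sub>R u i) powr p"
  defines "S \<equiv> (\<Sum>i\<in>UNIV. a i)"
  defines "e \<equiv> \<lambda>i. 1 + a i / (p * S)"
  shows "S powr (1 / p) * (\<Prod>i\<in>UNIV. l i powr e i / e i) \<le> measure mu (box_sum u l UNIV)"
proof -
  define v where "v = (\<lambda>i. \<sigma> i *\<^sub>R u i)"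
  have a: "a i > 0" for i
    using pos[of i] by (simp add: a_def)
  have S: "S > 0"
    unfolding S_def by (intro sum_pos) (auto simp: a)
  \<comment> \<open>Passes from standard coordinates to those of the basis \<open>v\<close>; as an
    isometry it leaves the Lebesgue integral unchanged.\<close>
  define T where "T = (\<lambda>c::real^'n. \<Sum>i\<in>UNIV. (c $ i) *\<^sub>R v i)"
  have sq: "\<sigma> i * \<sigma> i = 1" for i
    using \<sigma>[of i] by auto
  have vv: "v i \<bullet> v j = (if i = j then 1 else 0)" for i j
    using u by (simp add: v_def orthonormal_basis_def sq)
  have T_lin: "linear T"
    unfolding T_def by (intro linearI) (simp_all add: scaleR_left_distrib sum.distrib scaleR_sum_right)
  have T_norm: "norm (T c) = norm c" for c
  proof -
    have "T c \<bullet> T c = (\<Sum>i\<in>UNIV. \<Sum>j\<in>UNIV. (c $ i) * ((c $ j) * (v j \<bullet> v i)))"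
      by (simp add: T_def inner_sum_left inner_sum_right sum_distrib_left)
    also have "\<dots> = (\<Sum>i\<in>UNIV. (c $ i) * (c $ i))"
      by (simp add: vv if_distrib cong: if_cong)
    also have "\<dots> = c \<bullet> c"
      by (simp add: inner_vec_def)
    finally show ?thesis
      by (simp add: norm_eq_sqrt_inner)
  qed
  have T_inv: "T (\<chi> i. x \<bullet> v i) = x" for x
  proof -
    have "T (\<chi> i. x \<bullet> v i) = (\<Sum>i\<in>UNIV. (\<sigma> i * \<sigma> i) *\<^sub>R (x \<bullet> u i) *\<^sub>R u i)"
      by (simp add: T_def v_def mult_ac)
    then show ?thesis
      by (simp add: sq orthonormal_basis_expansion[OF u])
  qed
  let ?Z = "box_sum u l UNIV"
  note [measurable] = borel_compact[OF compact_box_sum[of u l UNIV]]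
  have exponent: "a i / (p * S) = (a i / S) * (1 / p)" for i
    by simp
  have pw: "ennreal (S powr (1 / p)) * (\<Prod>i\<in>UNIV. ennreal ((c $ i) powr (a i / (p * S))) * indicator {0<..l i} (c $ i))
      \<le> ennreal (g (T c)) * indicator ?Z (T c)" for c :: "real^'n"
  proof (cases "\<forall>i. c $ i \<in> {0<..l i}")
    case True
    then have c: "c $ i > 0" "c $ i \<le> l i" for i
      by auto
    have "(\<Sum>i\<in>UNIV. (c $ i * \<sigma> i) *\<^sub>R u i) \<in> ?Z"
    proof (rule sum_scaleR_mem_box_sum)
      show "\<bar>c $ i * \<sigma> i\<bar> \<le> l i \<and> l i > 0" for i
        using c[of i] l[of i] \<sigma>[of i] by (auto simp: abs_mult)
    qed simp
    then have "T c \<in> ?Z"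
      by (simp add: T_def v_def)
    \<comment> \<open>The weights \<open>a i / S\<close> sum to \<open>1\<close> and reproduce the
      coefficients \<open>a i\<close> up to the factor \<open>S\<close>; they are the source of the
      exponents in the theorem.\<close>
    have "(\<Prod>i\<in>UNIV. (c $ i) powr (a i / S)) \<le> (\<Sum>i\<in>UNIV. a i / S * c $ i)"
      using a S c by (intro weighted_arith_geom_mean)
        (auto simp: S_def sum_divide_distrib[symmetric] intro: less_imp_le)
    also have "\<dots> = (\<Sum>i\<in>UNIV. c $ i * a i) / S"
      by (simp add: sum_divide_distrib mult_ac)
    finally have "S * (\<Prod>i\<in>UNIV. (c $ i) powr (a i / S)) \<le> (\<Sum>i\<in>UNIV. c $ i * a i)"
      using S by (simp add: field_simps)
    also have "\<dots> \<le> g (T c) powr p"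
      using g_sum_lower[of UNIV v "\<lambda>i. c $ i"] c pos by (simp add: T_def v_def a_def)
    finally have "(S * (\<Prod>i\<in>UNIV. (c $ i) powr (a i / S))) powr (1 / p) \<le> (g (T c) powr p) powr (1 / p)"
      using p_pos S by (intro powr_mono2) (auto intro!: mult_nonneg_nonneg prod_nonneg)
    also have "(g (T c) powr p) powr (1 / p) = g (T c)"
      using g_nonneg[of "T c"] p_pos by (simp add: powr_powr)
    also have "(S * (\<Prod>i\<in>UNIV. (c $ i) powr (a i / S))) powr (1 / p)
        = S powr (1 / p) * (\<Prod>i\<in>UNIV. (c $ i) powr (a i / (p * S)))"
      using S by (simp add: powr_mult prod_nonneg prod_powr_distrib powr_powr exponent)
    finally have "ennreal (S powr (1 / p) * (\<Prod>i\<in>UNIV. (c $ i) powr (a i / (p * S)))) \<le> ennreal (g (T c))"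
      by (rule ennreal_leI)
    with \<open>T c \<in> ?Z\<close> show ?thesis
      using c by (simp add: ennreal_mult prod_nonneg prod_ennreal)
  next
    case False
    then obtain j where "c $ j \<notin> {0<..l j}"
      by blast
    then have "ennreal ((c $ j) powr (a j / (p * S))) * indicator {0<..l j} (c $ j) = 0"
      by simp
    then have "(\<Prod>i\<in>UNIV. ennreal ((c $ i) powr (a i / (p * S))) * indicator {0<..l i} (c $ i)) = 0"
      by (subst prod.remove[of UNIV j]) simp_all
    then show ?thesis
      by (simp only: mult_zero_right zero_le)
  qed
  have e: "e i > 0" for i
    using a[of i] S p_pos by (simp add: e_def add_pos_pos)
  have "ennreal (S powr (1 / p) * (\<Prod>i\<in>UNIV. l i powr e i / e i))
      = ennreal (S powr (1 / p)) * (\<Prod>i\<in>UNIV. ennreal (l i powr e i / e i))"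
    using e by (simp add: ennreal_mult prod_nonneg prod_ennreal less_imp_le)
  also have "\<dots> = ennreal (S powr (1 / p)) * (\<Prod>i\<in>UNIV. \<integral>\<^sup>+t. ennreal (t powr (a i / (p * S))) * indicator {0<..l i} t \<partial>lborel)"
    using a S p_pos l by (simp add: nn_integral_powr_Ioc e_def)
  also have "\<dots> = (\<integral>\<^sup>+c. ennreal (S powr (1 / p)) *
      (\<Prod>i\<in>UNIV. ennreal ((c $ i) powr (a i / (p * S))) * indicator {0<..l i} (c $ i)) \<partial>(lborel :: (real^'n) measure))"
  proof -
    have [measurable]: "(\<lambda>c::real^'n. c $ i) \<in> borel_measurable borel" for i
      by (intro borel_measurable_continuous_onI continuous_intros)
    show ?thesis
      by (subst nn_integral_cmult) (measurable, subst nn_integral_vec_prod[symmetric], measurable)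
  qed
  also have "\<dots> \<le> (\<integral>\<^sup>+c. ennreal (g (T c)) * indicator ?Z (T c) \<partial>lborel)"
    by (intro nn_integral_mono pw)
  also have "\<dots> = (\<integral>\<^sup>+x. ennreal (g x) * indicator ?Z x \<partial>lborel)"
    by (intro nn_integral_lborel_isometry[OF T_lin T_norm T_inv]) measurable
  also have "\<dots> = ennreal (measure mu ?Z)"
    by (simp add: emeasure_mu[symmetric] emeasure_mu_compact compact_box_sum)
  finally show ?thesis
    by (simp add: ennreal_le_iff)
qed

subsection \<open>The main inequality\<close>

text \<open>The difference quotient of \<open>t K\<close> at step \<open>t * \<delta> k\<close> is
  \<open>t powr (N - 1)\<close> times that of \<open>K\<close> at step \<open>\<delta> k\<close>:
  the measures contribute \<open>t powr N\<close>, the step removes one power. Uniqueness of limits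
  transfers this to the flux.\<close>

lemma flux_scale:
  assumes K: "compact K" "convex K" and \<theta>: "norm \<theta> = 1" and t: "t > 0"
  shows "flux ((\<lambda>x. t *\<^sub>R x) ` K) \<theta> = t powr (N - 1) * flux K \<theta>"
proof -
  define \<delta> where "\<delta> = (\<lambda>k. inverse (real (Suc k)))"
  have \<delta>: "\<delta> k > 0" for k
    by (simp add: \<delta>_def)
  have \<delta>0: "\<delta> \<longlonglongrightarrow> 0"
    unfolding \<delta>_def by (rule LIMSEQ_inverse_real_of_nat)
  let ?D = "\<lambda>A e. measure mu (A + (\<lambda>b. e *\<^sub>R b) ` sym_segment \<theta>) - measure mu A"
  have base: "(\<lambda>k. ?D A (\<epsilon> k) / \<epsilon> k) \<longlonglongrightarrow> flux A \<theta>"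
    if "compact A" "convex A" "\<And>k. \<epsilon> k > 0" "\<epsilon> \<longlonglongrightarrow> 0" for A and \<epsilon> :: "nat \<Rightarrow> real"
    using that \<theta> by (intro first_variation_mu[where \<eta> = "\<lambda>_. 0"]) auto
  have "(\<lambda>k. ?D ((\<lambda>x. t *\<^sub>R x) ` K) (t * \<delta> k) / (t * \<delta> k)) \<longlonglongrightarrow> flux ((\<lambda>x. t *\<^sub>R x) ` K) \<theta>"
    using \<delta> t tendsto_mult_right_zero[OF \<delta>0, of t]
    by (intro base compact_scaling convex_scaling K) auto
  moreover have "?D ((\<lambda>x. t *\<^sub>R x) ` K) (t * \<delta> k) / (t * \<delta> k) = t powr (N - 1) * (?D K (\<delta> k) / \<delta> k)" for k
  proof -
    have "(\<lambda>x. t *\<^sub>R x) ` K + (\<lambda>b. (t * \<delta> k) *\<^sub>R b) ` sym_segment \<theta>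
        = (\<lambda>x. t *\<^sub>R x) ` (K + (\<lambda>b. \<delta> k *\<^sub>R b) ` sym_segment \<theta>)"
      by (simp add: scaleR_image_set_plus image_image)
    then have "?D ((\<lambda>x. t *\<^sub>R x) ` K) (t * \<delta> k) = t powr N * ?D K (\<delta> k)"
      using t K by (simp add: measure_mu_scale compact_set_plus compact_scaling compact_sym_segment
          right_diff_distrib)
    then show ?thesis
      using t by (simp add: powr_diff)
  qed
  ultimately have "(\<lambda>k. t powr (N - 1) * (?D K (\<delta> k) / \<delta> k)) \<longlonglongrightarrow> flux ((\<lambda>x. t *\<^sub>R x) ` K) \<theta>"
    by simp
  moreover have "(\<lambda>k. t powr (N - 1) * (?D K (\<delta> k) / \<delta> k)) \<longlonglongrightarrow> t powr (N - 1) * flux K \<theta>"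
    using K \<delta> \<delta>0 by (intro tendsto_mult_left base)
  ultimately show ?thesis
    by (rule LIMSEQ_unique)
qed

text \<open>The quotient converges along every positive null sequence, by the first variation with
  the constant family \<open>L k = K\<close>. Thus the one-sided limit exists and the lower limit
  equals it.\<close>

lemma mixed_measure_mu_sym_segment:
  assumes K: "compact K" "convex K" and \<theta>: "norm \<theta> = 1"
  shows "mixed_measure mu K (sym_segment \<theta>) = ereal (flux K \<theta>)"
proof -
  let ?D = "\<lambda>e. (measure mu (K + (\<lambda>b. e *\<^sub>R b) ` sym_segment \<theta>) - measure mu K) / e"
  have "(?D \<longlongrightarrow> flux K \<theta>) (at_right 0)"
  proof (rule tendsto_at_right_sequentially[of 0 1])
    fix S :: "nat \<Rightarrow> real"
    assume "\<And>n. 0 < S n" "S \<longlonglongrightarrow> 0"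
    then show "(\<lambda>n. ?D (S n)) \<longlonglongrightarrow> flux K \<theta>"
      using K \<theta> by (intro first_variation_mu[where \<eta> = "\<lambda>_. 0"]) auto
  qed simp
  then have "((\<lambda>e. ereal (?D e)) \<longlongrightarrow> ereal (flux K \<theta>)) (at_right 0)"
    by (rule tendsto_ereal)
  then have "Liminf (at_right 0) (\<lambda>e. ereal (?D e)) = ereal (flux K \<theta>)"
    by (intro lim_imp_Liminf) simp
  moreover have "mixed_measure mu K (sym_segment \<theta>) = Liminf (at_right 0) (\<lambda>e. ereal (?D e))"
    unfolding mixed_measure_def
  proof (rule Liminf_eq)
    show "\<forall>\<^sub>F e in at_right 0.
        (enn2ereal (emeasure mu (K + (\<lambda>b. e *\<^sub>R b) ` sym_segment \<theta>)) - enn2ereal (emeasure mu K)) / ereal e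
          = ereal (?D e)"
      using eventually_at_right_less
    proof eventually_elim
      case (elim e)
      then show ?case
        using K by (simp add: emeasure_mu_compact compact_set_plus compact_scaling compact_sym_segment
            enn2ereal_ennreal)
    qed
  qed
  ultimately show ?thesis
    by simp
qed

lemma P_fun_mu:
  assumes K: "compact K" "convex K" and \<theta>: "norm \<theta> = 1"
  shows "P_fun mu K \<theta> = real CARD('n) / (2 * N) * flux K \<theta>"
proof -
  define F where "F = (\<lambda>t. real_of_ereal (mixed_measure mu ((\<lambda>x. t *\<^sub>R x) ` K) (sym_segment \<theta>)))"
  have F: "F t = t powr (N - 1) * flux K \<theta>" if "t > 0" for t
    unfolding F_def using that K \<theta>
    by (simp add: mixed_measure_mu_sym_segment compact_scaling convex_scaling flux_scale)
  have cont: "continuous_on {0..1} (\<lambda>t::real. t powr (N - 1))"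
    using N_gt_1 by (intro continuous_on_powr' continuous_intros) auto
  \<comment> \<open>The scaling law says nothing about \<open>t = 0\<close>, so this point is split
    off as a separate term supported on a null set. This also shows the integrand to be
    measurable.\<close>
  have F_eq: "indicator {0..1} t *\<^sub>R F t
      = indicator {0..1} t *\<^sub>R (t powr (N - 1) * flux K \<theta>) + indicator {0} t *\<^sub>R F 0" for t
    using F[of t] N_gt_1 by (cases "t = 0") (auto split: split_indicator)
  have "(LBINT t:{0..1}. F t) = (LBINT t:{0..1}. t powr (N - 1) * flux K \<theta>)"
    unfolding set_lebesgue_integral_def F_eq
  proof (rule integral_cong_AE)
    show "AE t in lborel. indicator {0..1} t *\<^sub>R (t powr (N - 1) * flux K \<theta>) + indicator {0} t *\<^sub>R F 0
        = indicator {0..1} t *\<^sub>R (t powr (N - 1) * flux K \<theta>)"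
      using AE_lborel_singleton[of "0::real"] by eventually_elim simp
  qed measurable
  also have "\<dots> = (LBINT t:{0..1}. t powr (N - 1)) * flux K \<theta>"
    by simp
  also have "(LBINT t:{0..1}. t powr (N - 1)) = integral {0..1} (\<lambda>t. t powr (N - 1))"
    by (intro set_borel_integral_eq_integral(2) borel_integrable_atLeastAtMost' cont)
  also have "\<dots> = 1 / N"
    using has_integral_powr_from_0[of "N - 1" 1] N_gt_1 by (simp add: integral_unique)
  finally show ?thesis
    by (simp add: P_fun_def F_def)
qed

text \<open>A support point \<open>t *\<^sub>R \<theta>\<close> has \<open>t \<noteq> 0\<close>,
  since \<open>g\<close> vanishes at \<open>0\<close>; homogeneity then carries positivity to
  \<open>sgn t *\<^sub>R \<theta>\<close>. At the opposite vector \<open>g\<close> is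
  \<open>0\<close>, so \<open>g_tilde\<close> reduces to a single value.\<close>

lemma g_tilde_unit_vector:
  assumes "sym_segment \<theta> \<inter> pos_supp g \<noteq> {}"
  obtains \<sigma> :: real where "\<sigma> = 1 \<or> \<sigma> = - 1" "g (\<sigma> *\<^sub>R \<theta>) > 0" "g_tilde g \<theta> = g (\<sigma> *\<^sub>R \<theta>)"
proof -
  obtain t where t: "g (t *\<^sub>R \<theta>) > 0"
    using assms by (auto simp: sym_segment_def pos_supp_def)
  then have "t \<noteq> 0"
    using g_zero by auto
  define \<sigma> where "\<sigma> = sgn t"
  have \<sigma>: "\<sigma> = 1 \<or> \<sigma> = - 1"
    using \<open>t \<noteq> 0\<close> by (auto simp: \<sigma>_def sgn_if)
  have "\<bar>t\<bar> * \<sigma> = t"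
    by (auto simp: \<sigma>_def sgn_if)
  then have "g (t *\<^sub>R \<theta>) = \<bar>t\<bar> powr (1 / p) * g (\<sigma> *\<^sub>R \<theta>)"
    using g_scale[of "\<bar>t\<bar>" "\<sigma> *\<^sub>R \<theta>"] \<open>t \<noteq> 0\<close> by simp
  then have pos: "g (\<sigma> *\<^sub>R \<theta>) > 0"
    using t g_nonneg[of "\<sigma> *\<^sub>R \<theta>"] by (auto simp: zero_less_mult_iff)
  moreover have "g_tilde g \<theta> = g (\<sigma> *\<^sub>R \<theta>) + g (- (\<sigma> *\<^sub>R \<theta>))"
    using \<sigma> by (auto simp: g_tilde_def)
  ultimately show thesis
    using that \<sigma> g_neg_zero by simp
qed

text \<open>The bounds \<open>P i\<close> keep \<open>l i = 1 / P i\<close> meaningful when \<open>P_fun mu K (u i)\<close> vanishes.\<close>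
lemma measure_mu_le_prod_P:
  assumes K: "compact K" "convex K" and u: "orthonormal_basis u"
    and supp: "\<And>i. sym_segment (u i) \<inter> pos_supp g \<noteq> {}"
    and P: "\<And>i. P i > 0" and PK: "\<And>i. P_fun mu K (u i) \<le> P i"
  defines "a \<equiv> \<lambda>i. g_tilde g (u i) powr p"
  defines "S \<equiv> (\<Sum>i\<in>UNIV. a i)"
  shows "measure mu K powr (N - 1)
    \<le> 2 powr N * (1 + 1 / (p * real CARD('n))) ^ CARD('n) * S powr (- (1 / p))
       * (\<Prod>i\<in>UNIV. P i powr (1 + a i / (p * S)))"
proof (cases "measure mu K > 0")
  case True
  define M where "M = measure mu K"
  define e where "e = (\<lambda>i. 1 + a i / (p * S))"
  define l where "l = (\<lambda>i. 1 / P i)"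
  have l: "l i > 0" for i
    using P by (simp add: l_def)
  have "\<forall>i. \<exists>\<sigma>::real. (\<sigma> = 1 \<or> \<sigma> = - 1) \<and> g (\<sigma> *\<^sub>R u i) > 0 \<and> g_tilde g (u i) = g (\<sigma> *\<^sub>R u i)"
    using g_tilde_unit_vector[OF supp] by blast
  then obtain \<sigma> :: "'n \<Rightarrow> real" where \<sigma>: "\<And>i. \<sigma> i = 1 \<or> \<sigma> i = - 1" "\<And>i. g (\<sigma> i *\<^sub>R u i) > 0"
      "\<And>i. g_tilde g (u i) = g (\<sigma> i *\<^sub>R u i)"
    by metis
  have a: "a i > 0" for i
    using \<sigma>(2,3)[of i] by (simp add: a_def)
  have S: "S > 0"
    unfolding S_def by (intro sum_pos) (auto simp: a)
  have e: "e i > 0" for i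
    using a[of i] S p_pos by (simp add: e_def add_pos_pos)
  have norm_u: "norm (u i) = 1" for i
    using u by (simp add: orthonormal_basis_def norm_eq_sqrt_inner)
  define z where "z = measure mu (box_sum u l UNIV)"
  define z0 where "z0 = S powr (1 / p) * (\<Prod>i\<in>UNIV. l i powr e i / e i)"
  have "z0 \<le> z"
    using measure_box_sum_lower[OF u \<sigma>(1,2) l] by (simp add: z0_def z_def e_def S_def a_def \<sigma>(3))
  have "0 < l i powr e i / e i" for i
    using e[of i] l[of i] by simp
  then have "z0 > 0"
    unfolding z0_def using S by (intro mult_pos_pos prod_pos) auto
  have "z > 0"
    using \<open>z0 > 0\<close> \<open>z0 \<le> z\<close> by linarith
  have "N * M * (z / M) powr (1 / N) \<le> (\<Sum>i\<in>UNIV. l i * flux K (u i))"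
    using minkowski_box_sum[OF K norm_u l] True \<open>z > 0\<close> by (simp add: M_def z_def)
  \<comment> \<open>The choice \<open>l i = 1 / P i\<close> cancels \<open>P i\<close> from each
    term, and \<open>2 * N / n\<close> is the inverse of the constant in
    \<open>P_fun_mu\<close>.\<close>
  also have "\<dots> \<le> (\<Sum>i\<in>(UNIV :: 'n set). 2 * N / real CARD('n))"
  proof (intro sum_mono)
    fix i
    have "flux K (u i) = 2 * N / real CARD('n) * P_fun mu K (u i)"
      using N_gt_1 by (simp add: P_fun_mu[OF K norm_u])
    also have "\<dots> \<le> 2 * N / real CARD('n) * P i"
      using N_gt_1 by (intro mult_left_mono PK) auto
    finally show "l i * flux K (u i) \<le> 2 * N / real CARD('n)"
      using P[of i] by (simp add: l_def field_simps)
  qed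
  also have "\<dots> = 2 * N"
    by simp
  finally have "M * (z / M) powr (1 / N) \<le> 2"
    using N_gt_1 by simp
  \<comment> \<open>The power \<open>N\<close> removes the root from \<open>z / M\<close> and leaves
    \<open>M powr (N - 1) * z\<close>, where \<open>z\<close> may be replaced by its lower bound
    \<open>z0\<close>.\<close>
  then have "(M * (z / M) powr (1 / N)) powr N \<le> 2 powr N"
    using N_gt_1 by (intro powr_mono2) (auto simp: M_def)
  also have "(M * (z / M) powr (1 / N)) powr N = M powr N * (z / M)"
    using True \<open>z > 0\<close> N_gt_1 by (simp add: M_def powr_mult powr_powr)
  also have "\<dots> = M powr (N - 1) * z"
    using True by (simp add: M_def powr_diff)
  finally have "M powr (N - 1) * z0 \<le> 2 powr N"
    using mult_left_mono[OF \<open>z0 \<le> z\<close>, of "M powr (N - 1)"] by simp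
  then have "M powr (N - 1) \<le> 2 powr N / z0"
    using \<open>z0 > 0\<close> by (simp add: field_simps)
  also have "\<dots> = 2 powr N * (\<Prod>i\<in>UNIV. e i) * S powr (- (1 / p)) * (\<Prod>i\<in>UNIV. P i powr e i)"
  proof -
    have "l i powr e i = 1 / P i powr e i" for i
      using P[of i] by (simp add: l_def powr_divide)
    then have "z0 = S powr (1 / p) * (1 / ((\<Prod>i\<in>UNIV. e i) * (\<Prod>i\<in>UNIV. P i powr e i)))"
      by (simp add: z0_def prod_dividef prod.distrib[symmetric] mult.commute)
    then show ?thesis
      by (simp add: powr_minus divide_inverse mult_ac)
  qed
  \<comment> \<open>The \<open>e i\<close> sum to \<open>n + 1 / p\<close>, so their mean is
    \<open>1 + 1 / (p * n)\<close>; AM--GM removes the individual \<open>e i\<close> from the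
    constant.\<close>
  also have "\<dots> \<le> 2 powr N * (1 + 1 / (p * real CARD('n))) ^ CARD('n) * S powr (- (1 / p)) * (\<Prod>i\<in>UNIV. P i powr e i)"
  proof -
    have "(\<Sum>i\<in>UNIV. e i) = real CARD('n) + 1 / p"
      using S by (simp add: e_def sum.distrib sum_divide_distrib[symmetric] S_def[symmetric])
    then have "(\<Sum>i\<in>UNIV. e i) / real CARD('n) = 1 + 1 / (p * real CARD('n))"
      by (simp add: add_divide_distrib)
    then have "(\<Prod>i\<in>UNIV. e i) \<le> (1 + 1 / (p * real CARD('n))) ^ CARD('n)"
      using prod_le_mean_power[of e] e by simp
    then show ?thesis
      by (intro mult_right_mono mult_left_mono prod_nonneg) auto
  qed
  finally show ?thesis
    by (simp add: M_def e_def)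
next
  \<comment> \<open>If \<open>mu(K) = 0\<close>, the left side is \<open>0 powr (N - 1) = 0\<close>
    and the right side is nonnegative.\<close>
  case False
  then have "measure mu K = 0"
    by (simp add: zero_less_measure_iff)
  moreover have "0 \<le> 1 + 1 / (p * real CARD('n))"
    using p_pos by simp
  ultimately show ?thesis
    by (auto intro!: mult_nonneg_nonneg prod_nonneg)
qed

end

theorem theorem1p6:
  fixes p :: real
    and g :: "real^'n \<Rightarrow> real"
    and \<mu> :: "(real^'n) measure"
    and u :: "'n \<Rightarrow> real^'n"
    and K :: "(real^'n) set"
  assumes "p > 0"
    and "\<And>x. g x \<ge> 0"
    and "continuous_on UNIV g"
    and "p_concave p g"
    and "homogeneous_of_degree (1 / p) g"
    and "\<mu> = density lborel (\<lambda>x. ennreal (g x))"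
    and "orthonormal_basis u"
    and "\<And>i. sym_segment (u i) \<inter> pos_supp g \<noteq> {}"
    and "convex_body K"
  shows "measure \<mu> K powr (real CARD('n) + 1 / p - 1)
    \<le> 2 powr (real CARD('n) + 1 / p)
       * (1 + 1 / (p * real CARD('n))) ^ CARD('n)
       * (\<Sum>k\<in>UNIV. g_tilde g (u k) powr p) powr (- (1 / p))
       * (\<Prod>i\<in>UNIV. P_fun \<mu> K (u i) powr
            (1 + g_tilde g (u i) powr p / (p * (\<Sum>k\<in>UNIV. g_tilde g (u k) powr p))))"
proof -
  interpret homogeneous_concave_density p g
    using assms(1-5) by unfold_locales
  have \<mu>: "\<mu> = mu"
    by (simp add: assms(6) mu_def)
  have K: "compact K" "convex K"
    using assms(9) by (auto simp: convex_body_def)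
  define S where "S = (\<Sum>k\<in>UNIV. g_tilde g (u k) powr p)"
  define e where "e = (\<lambda>i. 1 + g_tilde g (u i) powr p / (p * S))"
  define C where "C = 2 powr N * (1 + 1 / (p * real CARD('n))) ^ CARD('n) * S powr (- (1 / p))"
  \<comment> \<open>Only nonnegativity of \<open>P_fun mu K (u i)\<close> is known, while positive
    bounds are required; adding \<open>d k\<close> supplies them, and the limit \<open>d k\<close>
    to \<open>0\<close> recovers the claim.\<close>
  define d where "d = (\<lambda>k. inverse (real (Suc k)))"
  have norm_u: "norm (u i) = 1" for i
    using assms(7) by (simp add: orthonormal_basis_def norm_eq_sqrt_inner)
  have P: "P_fun mu K (u i) \<ge> 0" for i
    using N_gt_1 flux_nonneg by (simp add: P_fun_mu[OF K norm_u])
  have e: "e i > 0" for i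
    unfolding e_def S_def using assms(1)
    by (intro add_pos_nonneg divide_nonneg_nonneg mult_nonneg_nonneg sum_nonneg) auto
  have "measure mu K powr (N - 1) \<le> C * (\<Prod>i\<in>UNIV. (P_fun mu K (u i) + d k) powr e i)" for k
    unfolding C_def S_def e_def
    by (rule measure_mu_le_prod_P[OF K assms(7,8)]) (auto simp: d_def intro: add_nonneg_pos P)
  moreover have "(\<lambda>k. C * (\<Prod>i\<in>UNIV. (P_fun mu K (u i) + d k) powr e i))
      \<longlonglongrightarrow> C * (\<Prod>i\<in>UNIV. (P_fun mu K (u i) + 0) powr e i)"
  proof (intro tendsto_mult_left tendsto_prod tendsto_powr' tendsto_add tendsto_const)
    show "d \<longlonglongrightarrow> 0"
      unfolding d_def by (rule LIMSEQ_inverse_real_of_nat)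
    \<comment> \<open>At a vanishing base the limit of the power relies on \<open>e i > 0\<close>
      and on nonnegative approximants.\<close>
    show "P_fun mu K (u i) + 0 \<noteq> 0 \<or> e i > 0 \<and> (\<forall>\<^sub>F k in sequentially. 0 \<le> P_fun mu K (u i) + d k)" for i
      using e[of i] P[of i] by (auto simp: d_def)
  qed
  ultimately have "measure mu K powr (N - 1) \<le> C * (\<Prod>i\<in>UNIV. (P_fun mu K (u i) + 0) powr e i)"
    by (intro LIMSEQ_le_const) auto
  then show ?thesis
    by (simp add: \<mu> C_def S_def e_def N_def)
qed

end
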